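(* Let $p>1$. Let $(X,\mathcal{A},e)$ be SPQR relatively hyperbolic, where $\mathcal{A}=\{A_i:i\in I\}$. Suppose we are given maps $\psi_i:A_i\to\ell^p(X_i)$ and a concave function $\rho':\mathbb{R}_{\geq0}\to\mathbb{R}_{\geq0}$ such that for all $i$ and all $x,y\in A_i$, \[ \rho'(d(x,y))\leq\|\psi_i(x)-\psi_i(y)\|_p\leq d(x,y). \] Then for every function $f:\mathbb{N}\to\mathbb{R}_{\geq0}$ with property $(C_p^c)$ there exists a coarse embedding $\phi$ of $X$ into some $\ell^p$ space such that for all $x,y\in X$, \[ \rho(d(x,y))\preceq\|\phi(x)-\phi(y)\|_p\preceq d(x,y), \] where $\rho(n)=\min\{\rho'(n),f(n)\}$.
   Context: Setting: $X$ is the vertex set of a connected simplicial graph of bounded geometry (uniformly bounded degree) with shortest path metric $d$, $e\in X$ a basepoint, and $\mathcal{A}=\{A_i\}_{i\in I}$ a countable collection of subsets ("pieces") covering $X$. All geodesics considered run from a point $x$ to $e$. For such a geodesic $g$ meeting $A_i$, its $i$-domain $g|_i$ is the convex hull in $g$ of $g\cap A_i$; viewing it as directed from $x$ towards $e$, $g|_i^+$ is its initial vertex and $g|_i^-$ its terminal vertex; the $i$-length is $l_i(g)=d(g|_i^-,g|_i^+)+1$. For $x\in X$, $k\in\mathbb{N}$, let $G_{x,k}$ be the set of all geodesics from points $y$ with $d(x,y)\leq k$ to $e$. For a set $G$ of such geodesics and $K\geq1$, $\partial_i^K(G)$ is the set of points $g|_i^+$ ($g\in G$ meeting $A_i$)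 such that for all $g'\in G$ and all $j\in I$ with $l_j(g')\geq5K$, $d(e,g|_i^+)\notin[d(e,g'|_j^-)+2K,\,d(e,g'|_j^+)-2K]$. Set $\partial_i^K(x)=\bigcup_{k\leq d(x,A_i)/4}\partial_i^K(G_{x,k})$ and let $I_x(K)$ be the set of $i\in I$ with $\partial_i^K(x)\neq\emptyset$ and $d(e,\partial_i^K(x))\geq3K$. $(X,\mathcal{A},e)$ is SPQR relatively hyperbolic if there is a constant $K>0$ such that: (C1) for every $i$ and any two geodesics (ending at $e$) $g_1,g_2$ meeting $A_i$, $d(g_1|_i^-,g_2|_i^-)\leq K$; (C2) for every $i$, all $x,y$ with $d(x,y)\leq\max\{d(x,A_i)/4,1\}$ and all geodesics $g_x$ from $x$ to $e$ and $g_y$ from $y$ to $e$ both meeting $A_i$, $d(g_x|_i^+,g_y|_i^+)\leq K$, and moreover if $g_x$ meets $A_i$ but $g_y\cap A_i=\emptyset$ then $l_i(g_x)\leq K$; (C3) $1\leq|\{i:x\in A_i\}|\leq K$ for all $x$ and $\mathrm{diam}(A_i\cap A_j)\leq K$ for $i\neq j$; (C4) $|\{i\in I_x(K):d(x,A_i)=t\}|\leq K$ for all $x\in X$ and $t\in\mathbb{N}$. A function is concave if non-decreasing with $f(n+m)-f(n)\leq f(n)-f(n-m)$ for $n\geq m$. $f$ has $(C_p^c)$ if it is concave, $\sum_{n\geq1}\frac1n\left(\frac{f(n)}n\right)^p<\infty$, and $f(n)^p/n$ is non-decreasing for all sufficiently large $n$. $A\preceq B$ means $A\leq CB+C$ for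 a constant $C$ independent of $x,y$.
   Formalization: The conclusion gives a map φ into ℓ^p with the two displayed inequalities but does not assert that φ is a coarse embedding; that assertion follows when ρ' is unbounded and is false in general when ρ' is bounded (e.g. ρ'=0, a single piece containing expanders). *)

theory Defs
  imports "HOL-Analysis.Analysis"
begin

text \<open>The vertex set X is the whole type 'v; E is the adjacency relation.\<close>

definition simplicial_graph :: "('v \<Rightarrow> 'v \<Rightarrow> bool) \<Rightarrow> bool" where
  "simplicial_graph E \<longleftrightarrow> (\<forall>x y. E x y \<longrightarrow> E y x) \<and> (\<forall>x. \<not> E x x)"

definition walk :: "('v \<Rightarrow> 'v \<Rightarrow> bool) \<Rightarrow> 'v list \<Rightarrow> bool" where
  "walk E xs \<longleftrightarrow> xs \<noteq> [] \<and> (\<forall>k. Suc k < length xs \<longrightarrow> E (xs ! k) (xs ! Suc k))"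

definition connected_graph :: "('v \<Rightarrow> 'v \<Rightarrow> bool) \<Rightarrow> bool" where
  "connected_graph E \<longleftrightarrow> (\<forall>x y. \<exists>xs. walk E xs \<and> hd xs = x \<and> last xs = y)"

definition bounded_degree :: "('v \<Rightarrow> 'v \<Rightarrow> bool) \<Rightarrow> bool" where
  "bounded_degree E \<longleftrightarrow> (\<exists>D::nat. \<forall>x. finite {y. E x y} \<and> card {y. E x y} \<le> D)"

definition gdist :: "('v \<Rightarrow> 'v \<Rightarrow> bool) \<Rightarrow> 'v \<Rightarrow> 'v \<Rightarrow> nat" where
  "gdist E x y = (LEAST n. \<exists>xs. walk E xs \<and> hd xs = x \<and> last xs = y \<and> length xs = Suc n)"

definition setdist :: "('v \<Rightarrow> 'v \<Rightarrow> bool) \<Rightarrow> 'v \<Rightarrow> 'v set \<Rightarrow> nat" where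
  "setdist E x A = Inf (gdist E x ` A)"

definition geodesic :: "('v \<Rightarrow> 'v \<Rightarrow> bool) \<Rightarrow> 'v \<Rightarrow> 'v \<Rightarrow> 'v list \<Rightarrow> bool" where
  "geodesic E x e g \<longleftrightarrow> walk E g \<and> hd g = x \<and> last g = e \<and> length g = Suc (gdist E x e)"

definition meets :: "'v list \<Rightarrow> 'v set \<Rightarrow> bool" where
  "meets g A \<longleftrightarrow> (\<exists>a\<in>set g. a \<in> A)"

definition dom_plus :: "'v list \<Rightarrow> 'v set \<Rightarrow> 'v" where
  "dom_plus g A = g ! (LEAST k. k < length g \<and> g ! k \<in> A)"

definition dom_minus :: "'v list \<Rightarrow> 'v set \<Rightarrow> 'v" where
  "dom_minus g A = g ! (GREATEST k. k < length g \<and> g ! k \<in> A)"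

definition ilen :: "('v \<Rightarrow> 'v \<Rightarrow> bool) \<Rightarrow> 'v list \<Rightarrow> 'v set \<Rightarrow> nat" where
  "ilen E g A = gdist E (dom_minus g A) (dom_plus g A) + 1"

definition Gset :: "('v \<Rightarrow> 'v \<Rightarrow> bool) \<Rightarrow> 'v \<Rightarrow> 'v \<Rightarrow> nat \<Rightarrow> 'v list set" where
  "Gset E e x k = {g. \<exists>y. gdist E x y \<le> k \<and> geodesic E y e g}"

definition bdry :: "('v \<Rightarrow> 'v \<Rightarrow> bool) \<Rightarrow> 'v \<Rightarrow> ('i \<Rightarrow> 'v set) \<Rightarrow> 'i set \<Rightarrow> real
                     \<Rightarrow> 'v list set \<Rightarrow> 'i \<Rightarrow> 'v set" where
  "bdry E e A I K G i =
     {dom_plus g (A i) | g. g \<in> G \<and> meets g (A i) \<and>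
        (\<forall>g'\<in>G. \<forall>j\<in>I. meets g' (A j) \<longrightarrow> real (ilen E g' (A j)) \<ge> 5 * K \<longrightarrow>
           real (gdist E e (dom_plus g (A i))) \<notin>
             {real (gdist E e (dom_minus g' (A j))) + 2 * K ..
              real (gdist E e (dom_plus g' (A j))) - 2 * K})}"

definition bdry_pt :: "('v \<Rightarrow> 'v \<Rightarrow> bool) \<Rightarrow> 'v \<Rightarrow> ('i \<Rightarrow> 'v set) \<Rightarrow> 'i set \<Rightarrow> real
                     \<Rightarrow> 'v \<Rightarrow> 'i \<Rightarrow> 'v set" where
  "bdry_pt E e A I K x i =
     (\<Union>k\<in>{k::nat. real k \<le> real (setdist E x (A i)) / 4}. bdry E e A I K (Gset E e x k) i)"

definition Ix :: "('v \<Rightarrow> 'v \<Rightarrow> bool) \<Rightarrow> 'v \<Rightarrow> ('i \<Rightarrow> 'v set) \<Rightarrow> 'i set \<Rightarrow> real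
                     \<Rightarrow> 'v \<Rightarrow> 'i set" where
  "Ix E e A I K x = {i\<in>I. bdry_pt E e A I K x i \<noteq> {} \<and>
                          real (setdist E e (bdry_pt E e A I K x i)) \<ge> 3 * K}"

definition SPQR_rel_hyp :: "('v \<Rightarrow> 'v \<Rightarrow> bool) \<Rightarrow> ('i \<Rightarrow> 'v set) \<Rightarrow> 'i set \<Rightarrow> 'v \<Rightarrow> bool" where
  "SPQR_rel_hyp E A I e \<longleftrightarrow>
    simplicial_graph E \<and> connected_graph E \<and> bounded_degree E \<and>
    countable I \<and> (\<Union>i\<in>I. A i) = UNIV \<and>
    (\<exists>K::real. K > 0 \<and>
      \<comment> \<open>(C1)\<close>
      (\<forall>i\<in>I. \<forall>x1 x2 g1 g2. geodesic E x1 e g1 \<longrightarrow> geodesic E x2 e g2 \<longrightarrow>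
          meets g1 (A i) \<longrightarrow> meets g2 (A i) \<longrightarrow>
          real (gdist E (dom_minus g1 (A i)) (dom_minus g2 (A i))) \<le> K) \<and>
      \<comment> \<open>(C2)\<close>
      (\<forall>i\<in>I. \<forall>x y gx gy.
          real (gdist E x y) \<le> max (real (setdist E x (A i)) / 4) 1 \<longrightarrow>
          geodesic E x e gx \<longrightarrow> geodesic E y e gy \<longrightarrow>
          (meets gx (A i) \<longrightarrow> meets gy (A i) \<longrightarrow>
             real (gdist E (dom_plus gx (A i)) (dom_plus gy (A i))) \<le> K) \<and>
          (meets gx (A i) \<longrightarrow> \<not> meets gy (A i) \<longrightarrow> real (ilen E gx (A i)) \<le> K)) \<and>
      \<comment> \<open>(C3)\<close>
      (\<forall>x. finite {i\<in>I. x \<in> A i} \<and> 1 \<le> card {i\<in>I. x \<in> A i} \<and>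
           real (card {i\<in>I. x \<in> A i}) \<le> K) \<and>
      (\<forall>i\<in>I. \<forall>j\<in>I. i \<noteq> j \<longrightarrow>
          (\<forall>a\<in>A i \<inter> A j. \<forall>b\<in>A i \<inter> A j. real (gdist E a b) \<le> K)) \<and>
      \<comment> \<open>(C4)\<close>
      (\<forall>x. \<forall>t::nat. finite {i\<in>Ix E e A I K x. setdist E x (A i) = t} \<and>
           real (card {i\<in>Ix E e A I K x. setdist E x (A i) = t}) \<le> K))"

definition lp_mem :: "real \<Rightarrow> ('a \<Rightarrow> real) \<Rightarrow> bool" where
  "lp_mem p u \<longleftrightarrow> (\<lambda>w. \<bar>u w\<bar> powr p) summable_on UNIV"

definition lp_norm :: "real \<Rightarrow> ('a \<Rightarrow> real) \<Rightarrow> real" where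
  "lp_norm p u = (\<Sum>\<^sub>\<infinity>w. \<bar>u w\<bar> powr p) powr (1 / p)"

definition concave_real :: "(real \<Rightarrow> real) \<Rightarrow> bool" where
  "concave_real f \<longleftrightarrow> (\<forall>s t. 0 \<le> s \<longrightarrow> s \<le> t \<longrightarrow> f s \<le> f t) \<and>
     (\<forall>n m. 0 \<le> m \<longrightarrow> m \<le> n \<longrightarrow> f (n + m) - f n \<le> f n - f (n - m))"

definition concave_nat :: "(nat \<Rightarrow> real) \<Rightarrow> bool" where
  "concave_nat f \<longleftrightarrow> mono f \<and>
     (\<forall>n m. m \<le> n \<longrightarrow> f (n + m) - f n \<le> f n - f (n - m))"

definition prop_Cpc :: "real \<Rightarrow> (nat \<Rightarrow> real) \<Rightarrow> bool" where
  "prop_Cpc p f \<longleftrightarrow> concave_nat f \<and>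
     summable (\<lambda>n. (1 / real (Suc n)) * (f (Suc n) / real (Suc n)) powr p) \<and>
     (\<exists>N. \<forall>n m. N \<le> n \<longrightarrow> n \<le> m \<longrightarrow> f n powr p / real n \<le> f m powr p / real m)"

end

theory Submission
  imports Defs
begin

text \<open>
  Three families of coordinates are used, each of them \<open>\<ell>\<^sup>p\<close>-Lipschitz along edges. The gate of
  \<open>x\<close> in \<open>A\<^sub>i\<close> is the point where a fixed geodesic from \<open>x\<close> to \<open>e\<close> enters \<open>A\<^sub>i\<close>, or a base point
  of \<open>A\<^sub>i\<close> if it misses \<open>A\<^sub>i\<close>; by (C1) and (C2), gates of points within distance about
  \<open>d(x, A\<^sub>i) / 5\<close> are uniformly close.

  (1) For each piece, the average of \<open>\<psi>\<^sub>i\<close> over the gates of a ball around \<open>x\<close> of radius comparable to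
  \<open>d(x, A\<^sub>i)\<close>. Along an edge it changes by \<open>O(1 / (1 + d(x, A\<^sub>i)))\<close>, which is \<open>p\<close>-summable over the
  pieces met by the geodesic because \<open>p > 1\<close>.
  (2) For each piece and each height \<open>h\<close> at which the geodesic runs through the piece, the number
  \<open>\<zeta>(\<tau>) \<tau>\<close> with \<open>\<tau> = d(x, e) - h\<close> and \<open>\<zeta>(n) = f(n) / n\<^bsup>1 + 1/p\<^esup>\<close>, multiplied by a cut-off.
  (3) The same for entry points whose height is not in the deep interior of a long piece; (C4) bounds
  their number.
  Property \<open>(C\<^sub>p\<^sup>c)\<close> says that \<open>\<Sum> \<zeta>(n)\<^sup>p\<close> converges, which bounds the variation of (2) and (3).

  For the lower bound let \<open>n = d(x, y)\<close> and \<open>d(y, e) \<le> d(x, e)\<close>, and look at the part of the geodesic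
  from \<open>x\<close> at distance between \<open>n/16\<close> and \<open>n/8\<close>. It carries about \<open>n\<close> coordinates of type (2) or (3), of
  size about \<open>f(n) / n\<^bsup>1/p\<^esup>\<close>. If all of them vanish at \<open>y\<close>, they contribute \<open>f(n)\<close>. Otherwise
  some piece has gates of \<open>x\<close> and \<open>y\<close> at distance at least \<open>n/2\<close>, and (1) contributes \<open>\<rho>'(n/2)\<close>.
\<close>

section \<open>The spaces \<open>\<ell>\<^sup>p\<close>\<close>

text \<open>Convexity of the power function is used on the open half-line only. An argument equal to
  0 is treated apart, through \<open>r powr p \<le> r\<close> for \<open>r\<close> between 0 and
  1.\<close>

lemma powr_convex_comb:
  fixes p s x y :: real
  assumes "p \<ge> 1" "0 \<le> x" "0 \<le> y" "0 \<le> s" "s \<le> 1"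
  shows "((1 - s) * x + s * y) powr p \<le> (1 - s) * x powr p + s * y powr p"
proof -
  have scale: "(r * z) powr p \<le> r * z powr p" if "0 \<le> r" "r \<le> 1" "0 \<le> z" for r z :: real
  proof -
    have "r powr p \<le> r powr 1" if "r > 0"
      using that \<open>r \<le> 1\<close> assms(1) by (intro powr_mono') auto
    then have "r powr p \<le> r"
      using \<open>0 \<le> r\<close> by (cases "r = 0") auto
    then show ?thesis
      using that by (simp add: powr_mult mult_right_mono)
  qed
  consider "x = 0" | "y = 0" | "x > 0" "y > 0" using assms by linarith
  then show ?thesis
  proof cases
    case 1 then show ?thesis using scale[of s y] assms by simp
  next
    case 2 then show ?thesis using scale[of "1 - s" x] assms by simp
  next
    case 3
    have "convex_on {0<..} (\<lambda>x::real. x powr p)"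
      using assms by (intro powr_convex) auto
    from convex_onD[OF this, of s x y] 3 assms show ?thesis by simp
  qed
qed

lemma lp_norm_nonneg [simp]: "0 \<le> lp_norm p u"
  by (simp add: lp_norm_def)

lemma lp_norm_powr: "p > 0 \<Longrightarrow> lp_norm p u powr p = (\<Sum>\<^sub>\<infinity>w. \<bar>u w\<bar> powr p)"
  by (simp add: lp_norm_def powr_powr infsum_nonneg)

lemma sum_le_lp_norm_powr:
  assumes "p > 0" "lp_mem p u" "finite F"
  shows "(\<Sum>w\<in>F. \<bar>u w\<bar> powr p) \<le> lp_norm p u powr p"
  using assms by (simp add: lp_norm_powr lp_mem_def finite_sum_le_infsum)

lemma lp_mem_bdd:
  assumes "\<And>F. finite F \<Longrightarrow> (\<Sum>w\<in>F. \<bar>u w\<bar> powr p) \<le> C"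
  shows "lp_mem p u"
  unfolding lp_mem_def
  by (rule nonneg_bdd_above_summable_on) (auto intro!: bdd_aboveI assms)

lemma lp_norm_le:
  assumes "p > 0" "C \<ge> 0" "\<And>F. finite F \<Longrightarrow> (\<Sum>w\<in>F. \<bar>u w\<bar> powr p) \<le> C powr p"
  shows "lp_norm p u \<le> C"
proof -
  have "lp_mem p u" using assms(3) by (rule lp_mem_bdd)
  then have "(\<Sum>\<^sub>\<infinity>w. \<bar>u w\<bar> powr p) \<le> C powr p"
    unfolding lp_mem_def by (rule infsum_le_finite_sums) (use assms in auto)
  then have "lp_norm p u powr p \<le> C powr p" using assms by (simp add: lp_norm_powr)
  then show ?thesis using assms by (meson lp_norm_nonneg not_le powr_less_mono2)
qed

lemma lp_norm_eq_0D:
  assumes "p > 0" "lp_mem p u" "lp_norm p u = 0"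
  shows "u w = 0"
  using sum_le_lp_norm_powr[OF assms(1,2), of "{w}"] assms
  by (simp add: powr_nonneg_iff)

lemma lp_mem_zero [simp]: "lp_mem p (\<lambda>w. 0)"
  by (simp add: lp_mem_def)

lemma lp_norm_zero [simp]: "lp_norm p (\<lambda>w. 0) = 0"
  by (simp add: lp_norm_def)

lemma lp_scale:
  assumes "p > 0" "lp_mem p u"
  shows "lp_mem p (\<lambda>w. c * u w)" and "lp_norm p (\<lambda>w. c * u w) = \<bar>c\<bar> * lp_norm p u"
proof -
  show "lp_mem p (\<lambda>w. c * u w)"
    using assms unfolding lp_mem_def
    by (simp add: abs_mult powr_mult summable_on_cmult_right)
  show "lp_norm p (\<lambda>w. c * u w) = \<bar>c\<bar> * lp_norm p u"
    using assms unfolding lp_norm_def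
    by (simp add: abs_mult powr_mult infsum_cmult_right' powr_powr)
qed

lemma lp_minus:
  assumes "p > 0" "lp_mem p u"
  shows "lp_mem p (\<lambda>w. - u w)" and "lp_norm p (\<lambda>w. - u w) = lp_norm p u"
  using lp_scale[OF assms, of "-1"] by auto

lemma lp_norm_diff_commute: "lp_norm p (\<lambda>w. u w - v w) = lp_norm p (\<lambda>w. v w - u w)"
  by (simp add: lp_norm_def abs_minus_commute)

text \<open>The quotient of \<open>\<bar>a\<bar> + \<bar>b\<bar>\<close> by
  \<open>\<alpha> + \<beta>\<close> is a convex combination of
  \<open>\<bar>a\<bar> / \<alpha>\<close> and \<open>\<bar>b\<bar> / \<beta>\<close>. With the two
  norms as \<open>\<alpha>\<close> and \<open>\<beta>\<close>, summation gives the triangle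
  inequality in \<open>lp_add\<close> without any duality.\<close>

lemma minkowski_powr:
  fixes \<alpha> \<beta> a b p :: real
  assumes "p \<ge> 1" "\<alpha> > 0" "\<beta> > 0"
  shows "\<bar>a + b\<bar> powr p \<le> (\<alpha> + \<beta>) powr p *
    ((\<alpha> / (\<alpha> + \<beta>)) * (\<bar>a\<bar> powr p / \<alpha> powr p) + (\<beta> / (\<alpha> + \<beta>)) * (\<bar>b\<bar> powr p / \<beta> powr p))"
proof -
  let ?s = "\<beta> / (\<alpha> + \<beta>)"
  have s: "1 - ?s = \<alpha> / (\<alpha> + \<beta>)" "0 \<le> ?s" "?s \<le> 1" using assms by (auto simp: field_simps)
  have "((\<alpha> / (\<alpha> + \<beta>)) * (\<bar>a\<bar> / \<alpha>) + ?s * (\<bar>b\<bar> / \<beta>)) = (\<bar>a\<bar> + \<bar>b\<bar>) / (\<alpha> + \<beta>)"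
    using assms by (simp add: add_divide_distrib)
  then have "((\<bar>a\<bar> + \<bar>b\<bar>) / (\<alpha> + \<beta>)) powr p \<le>
      (\<alpha> / (\<alpha> + \<beta>)) * (\<bar>a\<bar> / \<alpha>) powr p + ?s * (\<bar>b\<bar> / \<beta>) powr p"
    using powr_convex_comb[of p "\<bar>a\<bar> / \<alpha>" "\<bar>b\<bar> / \<beta>" ?s] s assms by simp
  then have "(\<bar>a\<bar> + \<bar>b\<bar>) powr p \<le> (\<alpha> + \<beta>) powr p *
      ((\<alpha> / (\<alpha> + \<beta>)) * (\<bar>a\<bar> powr p / \<alpha> powr p) + ?s * (\<bar>b\<bar> powr p / \<beta> powr p))"
    using assms by (simp add: powr_divide divide_simps mult_ac)
  moreover have "\<bar>a + b\<bar> powr p \<le> (\<bar>a\<bar> + \<bar>b\<bar>) powr p"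
    using assms by (intro powr_mono2) auto
  ultimately show ?thesis by linarith
qed

lemma lp_add:
  assumes "p \<ge> 1" "lp_mem p u" "lp_mem p v"
  shows "lp_mem p (\<lambda>w. u w + v w)" and "lp_norm p (\<lambda>w. u w + v w) \<le> lp_norm p u + lp_norm p v"
proof -
  have "lp_mem p (\<lambda>w. u w + v w) \<and> lp_norm p (\<lambda>w. u w + v w) \<le> lp_norm p u + lp_norm p v"
  proof (cases "lp_norm p u = 0 \<or> lp_norm p v = 0")
    case True
    then show ?thesis
    proof
      assume "lp_norm p u = 0"
      with lp_norm_eq_0D[of p u] assms have "u = (\<lambda>w. 0)" by auto
      with assms show ?thesis by simp
    next
      assume "lp_norm p v = 0"
      with lp_norm_eq_0D[of p v] assms have "v = (\<lambda>w. 0)" by auto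
      with assms show ?thesis by simp
    qed
  next
    case False
    define \<alpha> \<beta> where "\<alpha> = lp_norm p u" and "\<beta> = lp_norm p v"
    have pos: "\<alpha> > 0" "\<beta> > 0" using False lp_norm_nonneg[of p u] lp_norm_nonneg[of p v]
      unfolding \<alpha>_def \<beta>_def by linarith+
    have bd: "(\<Sum>w\<in>F. \<bar>u w + v w\<bar> powr p) \<le> (\<alpha> + \<beta>) powr p" if F: "finite F" for F
    proof -
      have "(\<Sum>w\<in>F. \<bar>u w + v w\<bar> powr p) \<le> (\<Sum>w\<in>F. (\<alpha> + \<beta>) powr p *
          ((\<alpha> / (\<alpha> + \<beta>)) * (\<bar>u w\<bar> powr p / \<alpha> powr p) + (\<beta> / (\<alpha> + \<beta>)) * (\<bar>v w\<bar> powr p / \<beta> powr p)))"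
        by (intro sum_mono minkowski_powr) (use assms pos in auto)
      also have "\<dots> = (\<alpha> + \<beta>) powr p *
          ((\<alpha> / (\<alpha> + \<beta>)) * ((\<Sum>w\<in>F. \<bar>u w\<bar> powr p) / \<alpha> powr p)
          + (\<beta> / (\<alpha> + \<beta>)) * ((\<Sum>w\<in>F. \<bar>v w\<bar> powr p) / \<beta> powr p))"
        by (simp only: sum.distrib sum_distrib_left[symmetric] sum_divide_distrib[symmetric])
      also have "\<dots> \<le> (\<alpha> + \<beta>) powr p * ((\<alpha> / (\<alpha> + \<beta>)) * 1 + (\<beta> / (\<alpha> + \<beta>)) * 1)"
        using sum_le_lp_norm_powr[of p u F] sum_le_lp_norm_powr[of p v F] assms F pos
        unfolding \<alpha>_def[symmetric] \<beta>_def[symmetric]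
        by (intro mult_left_mono add_mono) (auto simp: divide_le_eq_1)
      also have "\<dots> = (\<alpha> + \<beta>) powr p" using pos by (simp add: add_divide_distrib[symmetric])
      finally show ?thesis .
    qed
    then show ?thesis
      using lp_mem_bdd[OF bd] lp_norm_le[OF _ _ bd] assms pos unfolding \<alpha>_def \<beta>_def by auto
  qed
  then show "lp_mem p (\<lambda>w. u w + v w)" "lp_norm p (\<lambda>w. u w + v w) \<le> lp_norm p u + lp_norm p v"
    by auto
qed

lemma lp_diff:
  assumes "p \<ge> 1" "lp_mem p u" "lp_mem p v"
  shows "lp_mem p (\<lambda>w. u w - v w)" and "lp_norm p (\<lambda>w. u w - v w) \<le> lp_norm p u + lp_norm p v"
  using lp_add[OF assms(1,2), of "\<lambda>w. - v w"] lp_minus[of p v] assms by auto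

lemma lp_norm_triangle:
  assumes "p \<ge> 1" "lp_mem p u" "lp_mem p v" "lp_mem p z"
  shows "lp_norm p (\<lambda>w. u w - z w) \<le> lp_norm p (\<lambda>w. u w - v w) + lp_norm p (\<lambda>w. v w - z w)"
  using lp_add(2)[OF assms(1) lp_diff(1)[OF assms(1,2,3)] lp_diff(1)[OF assms(1,3,4)]] by simp

lemma lp_sum:
  assumes "p \<ge> 1" "finite S" "\<And>a. a \<in> S \<Longrightarrow> lp_mem p (u a)"
  shows "lp_mem p (\<lambda>w. \<Sum>a\<in>S. c a * u a w)"
    and "lp_norm p (\<lambda>w. \<Sum>a\<in>S. c a * u a w) \<le> (\<Sum>a\<in>S. \<bar>c a\<bar> * lp_norm p (u a))"
proof -
  have "lp_mem p (\<lambda>w. \<Sum>a\<in>S. c a * u a w) \<and>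
     lp_norm p (\<lambda>w. \<Sum>a\<in>S. c a * u a w) \<le> (\<Sum>a\<in>S. \<bar>c a\<bar> * lp_norm p (u a))"
    using assms(2,3)
  proof (induction S rule: finite_induct)
    case empty show ?case by simp
  next
    case (insert a S)
    have a: "lp_mem p (\<lambda>w. c a * u a w)" "lp_norm p (\<lambda>w. c a * u a w) = \<bar>c a\<bar> * lp_norm p (u a)"
      using lp_scale[of p "u a" "c a"] insert assms(1) by auto
    show ?case using lp_add[OF assms(1) a(1), of "\<lambda>w. \<Sum>a\<in>S. c a * u a w"] insert a by auto
  qed
  then show "lp_mem p (\<lambda>w. \<Sum>a\<in>S. c a * u a w)"
    "lp_norm p (\<lambda>w. \<Sum>a\<in>S. c a * u a w) \<le> (\<Sum>a\<in>S. \<bar>c a\<bar> * lp_norm p (u a))" by auto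
qed

section \<open>Direct sums, slices and reindexing of coordinates\<close>

lemma sum_Plus:
  fixes g :: "'a + 'b \<Rightarrow> real"
  assumes "finite F"
  shows "sum g F = (\<Sum>a\<in>Inl -` F. g (Inl a)) + (\<Sum>b\<in>Inr -` F. g (Inr b))"
proof -
  have F: "F = Inl ` (Inl -` F) \<union> Inr ` (Inr -` F)"
    by (auto simp: image_iff) (metis sum.exhaust)
  have fin: "finite (Inl -` F)" "finite (Inr -` F)"
    using assms by (auto intro: finite_vimageI)
  have "sum g F = sum g (Inl ` (Inl -` F)) + sum g (Inr ` (Inr -` F))"
    by (subst F, subst sum.union_disjoint) (use fin assms in auto)
  then show ?thesis by (simp add: sum.reindex del: image_vimage_eq)
qed

lemma lp_case_sum:
  assumes "p > 0" "lp_mem p u" "lp_mem p v"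
  shows "lp_mem p (case_sum u v)"
    and "lp_norm p (case_sum u v) powr p \<le> lp_norm p u powr p + lp_norm p v powr p"
    and "lp_norm p u \<le> lp_norm p (case_sum u v)"
    and "lp_norm p v \<le> lp_norm p (case_sum u v)"
proof -
  have bd: "(\<Sum>w\<in>F. \<bar>case_sum u v w\<bar> powr p) \<le> lp_norm p u powr p + lp_norm p v powr p"
    if F: "finite F" for F
    unfolding sum_Plus[OF F] using F assms
    by (auto intro!: add_mono sum_le_lp_norm_powr finite_vimageI)
  show m: "lp_mem p (case_sum u v)" using lp_mem_bdd[OF bd] .
  show "lp_norm p (case_sum u v) powr p \<le> lp_norm p u powr p + lp_norm p v powr p"
  proof -
    let ?C = "(lp_norm p u powr p + lp_norm p v powr p) powr (1 / p)"
    have "?C powr p = lp_norm p u powr p + lp_norm p v powr p"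
      using assms by (simp add: powr_powr)
    with lp_norm_le[of p ?C "case_sum u v"] bd assms have "lp_norm p (case_sum u v) \<le> ?C" by simp
    then have "lp_norm p (case_sum u v) powr p \<le> ?C powr p"
      using assms by (intro powr_mono2) auto
    then show ?thesis using assms by (simp add: powr_powr)
  qed
  show "lp_norm p u \<le> lp_norm p (case_sum u v)"
  proof (rule lp_norm_le)
    fix F :: "'a set" assume "finite F"
    then show "(\<Sum>w\<in>F. \<bar>u w\<bar> powr p) \<le> lp_norm p (case_sum u v) powr p"
      using sum_le_lp_norm_powr[OF assms(1) m, of "Inl ` F"] by (simp add: sum.reindex)
  qed (use assms in auto)
  show "lp_norm p v \<le> lp_norm p (case_sum u v)"
  proof (rule lp_norm_le)
    fix F :: "'b set" assume "finite F"
    then show "(\<Sum>w\<in>F. \<bar>v w\<bar> powr p) \<le> lp_norm p (case_sum u v) powr p"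
      using sum_le_lp_norm_powr[OF assms(1) m, of "Inr ` F"] by (simp add: sum.reindex)
  qed (use assms in auto)
qed

lemma case_sum_diff:
  "(\<lambda>l. case_sum u v l - case_sum u' v' l) = case_sum (\<lambda>a. u a - u' a) (\<lambda>b. (v b - v' b :: real))"
  by (auto split: sum.split)

lemma powr_le_imp_le:
  fixes a b p :: real
  assumes "a powr p \<le> b powr p" "0 < p" "0 \<le> b"
  shows "a \<le> b"
  using assms powr_less_mono2[of p b a] by linarith

text \<open>Extension by zero to the sum type does not increase the norm, and
  \<open>case_sum u v\<close> is the sum of the two extensions.\<close>

lemma lp_case_sum_le:
  fixes u :: "'a \<Rightarrow> real" and v :: "'b \<Rightarrow> real"
  assumes "p \<ge> 1" "lp_mem p u" "lp_mem p v"
  shows "lp_norm p (case_sum u v) \<le> lp_norm p u + lp_norm p v"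
proof -
  have p: "0 < p" using assms by simp
  let ?u = "case_sum u (\<lambda>_ :: 'b. 0)" and ?v = "case_sum (\<lambda>_ :: 'a. 0) v"
  have "lp_norm p ?u powr p \<le> lp_norm p u powr p" "lp_norm p ?v powr p \<le> lp_norm p v powr p"
    using lp_case_sum(2)[OF p assms(2) lp_mem_zero] lp_case_sum(2)[OF p lp_mem_zero assms(3)] p
    by simp_all
  then have le: "lp_norm p ?u \<le> lp_norm p u" "lp_norm p ?v \<le> lp_norm p v"
    using p by (auto dest: powr_le_imp_le)
  have "case_sum u v = (\<lambda>l. ?u l + ?v l)" by (auto split: sum.split)
  then have "lp_norm p (case_sum u v) \<le> lp_norm p ?u + lp_norm p ?v"
    using lp_add(2)[OF assms(1) lp_case_sum(1)[OF p assms(2) lp_mem_zero]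
        lp_case_sum(1)[OF p lp_mem_zero assms(3)]] by simp
  with le show ?thesis by linarith
qed

lemma lp_mem_finite_support:
  assumes "finite {l. u l \<noteq> 0}"
  shows "lp_mem p u"
proof (rule lp_mem_bdd)
  fix F :: "'a set" assume F: "finite F"
  have "(\<Sum>w\<in>F. \<bar>u w\<bar> powr p) = (\<Sum>w\<in>F \<inter> {l. u l \<noteq> 0}. \<bar>u w\<bar> powr p)"
    by (rule sum.mono_neutral_right) (use F in auto)
  also have "\<dots> \<le> (\<Sum>w\<in>{l. u l \<noteq> 0}. \<bar>u w\<bar> powr p)"
    by (rule sum_mono2) (use assms in auto)
  finally show "(\<Sum>w\<in>F. \<bar>u w\<bar> powr p) \<le> (\<Sum>w\<in>{l. u l \<noteq> 0}. \<bar>u w\<bar> powr p)" .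
qed

text \<open>The \<open>p\<close>-th powers of the norms add up over slices, and only slices in
  \<open>J\<close> contribute. This reduces estimates on pairs to estimates for one piece at a
  time.\<close>

lemma lp_slices:
  fixes u :: "'i \<Rightarrow> 'w \<Rightarrow> real"
  assumes "p > 0" "finite J" "\<And>i. i \<in> J \<Longrightarrow> lp_mem p (u i)" "\<And>i w. i \<notin> J \<Longrightarrow> u i w = 0" "finite F"
  shows "(\<Sum>l\<in>F. \<bar>case_prod u l\<bar> powr p) \<le> (\<Sum>i\<in>J. lp_norm p (u i) powr p)"
proof -
  have fF: "finite (snd ` F)" using assms by simp
  have "(\<Sum>l\<in>F. \<bar>case_prod u l\<bar> powr p) = (\<Sum>l\<in>F \<inter> (J \<times> snd ` F). \<bar>case_prod u l\<bar> powr p)"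
  proof (rule sum.mono_neutral_right)
    show "\<forall>l\<in>F - F \<inter> (J \<times> snd ` F). \<bar>case_prod u l\<bar> powr p = 0"
    proof
      fix l assume l: "l \<in> F - F \<inter> (J \<times> snd ` F)"
      then have "fst l \<notin> J" by (auto simp: mem_Times_iff)
      then show "\<bar>case_prod u l\<bar> powr p = 0" using assms(4) by (simp add: split_beta)
    qed
  qed (use assms in auto)
  also have "\<dots> \<le> (\<Sum>l\<in>J \<times> snd ` F. \<bar>case_prod u l\<bar> powr p)"
    by (rule sum_mono2) (use assms fF in auto)
  also have "\<dots> = (\<Sum>i\<in>J. \<Sum>w\<in>snd ` F. \<bar>u i w\<bar> powr p)"
    by (simp add: sum.cartesian_product split_beta)
  also have "\<dots> \<le> (\<Sum>i\<in>J. lp_norm p (u i) powr p)"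
    by (intro sum_mono sum_le_lp_norm_powr assms fF)
  finally show ?thesis .
qed

lemma lp_slice_le:
  assumes "p > 0" "lp_mem p u"
  shows "lp_norm p (\<lambda>w. u (i, w)) \<le> lp_norm p u"
proof (rule lp_norm_le)
  fix F :: "'b set" assume "finite F"
  then show "(\<Sum>w\<in>F. \<bar>u (i, w)\<bar> powr p) \<le> lp_norm p u powr p"
    using sum_le_lp_norm_powr[OF assms, of "Pair i ` F"] by (simp add: sum.reindex inj_on_def)
qed (use assms in auto)

lemma infsum_transfer_inj:
  fixes g :: "'a \<Rightarrow> real"
  assumes inj: "inj_on h S" and z: "\<And>a. a \<notin> S \<Longrightarrow> g a = 0" "\<And>n. n \<notin> h ` S \<Longrightarrow> g' n = 0"
    and eq: "\<And>a. a \<in> S \<Longrightarrow> g' (h a) = g a"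
  shows "g' summable_on UNIV \<longleftrightarrow> g summable_on UNIV" and "infsum g' UNIV = infsum g UNIV"
proof -
  have "g' summable_on UNIV \<longleftrightarrow> g' summable_on h ` S"
    by (rule summable_on_cong_neutral) (use z in auto)
  also have "\<dots> \<longleftrightarrow> (g' \<circ> h) summable_on S" by (rule summable_on_reindex[OF inj])
  also have "\<dots> \<longleftrightarrow> g summable_on UNIV" by (rule summable_on_cong_neutral) (use z eq in auto)
  finally show "g' summable_on UNIV \<longleftrightarrow> g summable_on UNIV" .
  have "infsum g' UNIV = infsum g' (h ` S)"
    by (rule infsum_cong_neutral) (use z in auto)
  also have "\<dots> = infsum (g' \<circ> h) S" by (rule infsum_reindex[OF inj])
  also have "\<dots> = infsum g UNIV" by (rule infsum_cong_neutral) (use z eq in auto)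
  finally show "infsum g' UNIV = infsum g UNIV" .
qed

text \<open>The coordinates constructed below carry labels from a sum of product types, while the
  final map is indexed by \<open>nat\<close>. Only countably many labels are ever nonzero, and
  moving them along the injection \<open>to_nat_on S\<close> changes no
  \<open>p\<close>-sum.\<close>

lemma lp_countable_to_nat:
  fixes \<Phi> :: "'v \<Rightarrow> 'l \<Rightarrow> real"
  assumes S: "countable S" and z: "\<And>x l. l \<notin> S \<Longrightarrow> \<Phi> x l = 0" and p: "p > 0"
  obtains \<phi> :: "'v \<Rightarrow> nat \<Rightarrow> real" where
    "\<And>x. lp_mem p (\<phi> x) \<longleftrightarrow> lp_mem p (\<Phi> x)"
    "\<And>x y. lp_norm p (\<lambda>n. \<phi> x n - \<phi> y n) = lp_norm p (\<lambda>l. \<Phi> x l - \<Phi> y l)"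
proof
  let ?h = "to_nat_on S"
  define \<phi> where "\<phi> x n = (if n \<in> ?h ` S then \<Phi> x (from_nat_into S n) else 0)" for x n
  note inj = inj_on_to_nat_on[OF S]
  have h: "\<phi> x (?h l) = \<Phi> x l" if "l \<in> S" for x l
    using that S by (simp add: \<phi>_def)
  show "lp_mem p (\<phi> x) \<longleftrightarrow> lp_mem p (\<Phi> x)" for x
    unfolding lp_mem_def
    by (rule infsum_transfer_inj(1)[OF inj]) (use z p h in \<open>auto simp: \<phi>_def\<close>)
  show "lp_norm p (\<lambda>n. \<phi> x n - \<phi> y n) = lp_norm p (\<lambda>l. \<Phi> x l - \<Phi> y l)" for x y
    unfolding lp_norm_def
    by (rule arg_cong[where f = "\<lambda>t. t powr (1 / p)"], rule infsum_transfer_inj(2)[OF inj])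
       (use z p h in \<open>auto simp: \<phi>_def\<close>)
qed

lemma lp_support_countable:
  assumes "p > 0" "lp_mem p u"
  shows "countable {w. u w \<noteq> 0}"
proof -
  have "countable {w \<in> UNIV. \<bar>u w\<bar> powr p \<noteq> 0}"
    using assms(2) unfolding lp_mem_def by (rule summable_countable_real)
  then show ?thesis by simp
qed

text \<open>Terms are grouped by the value of \<open>T\<close>. A bound on the number of labels at
  each scale and one convergent series thus give a uniform bound; both the tents and the averages
  are estimated in this way.\<close>

lemma sum_fibre_le:
  fixes g :: "nat \<Rightarrow> real"
  assumes fin: "finite F" and g: "\<And>t. 0 \<le> g t" "summable g"
    and M: "\<And>t. card {l \<in> F. T l = t} \<le> M"
  shows "(\<Sum>l\<in>F. g (T l)) \<le> real M * suminf g"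
proof -
  have "(\<Sum>l\<in>F. g (T l)) = (\<Sum>t\<in>T ` F. \<Sum>l\<in>{l \<in> F. T l = t}. g (T l))"
    by (rule sum.image_gen[OF fin])
  also have "\<dots> = (\<Sum>t\<in>T ` F. real (card {l \<in> F. T l = t}) * g t)"
    by (intro sum.cong) auto
  also have "\<dots> \<le> (\<Sum>t\<in>T ` F. real M * g t)"
    using M g by (intro sum_mono mult_right_mono) auto
  also have "\<dots> = real M * (\<Sum>t\<in>T ` F. g t)" by (simp add: sum_distrib_left)
  also have "\<dots> \<le> real M * suminf g"
    using fin g by (intro mult_left_mono sum_le_suminf) auto
  finally show ?thesis .
qed

lemma summable_inverse_Suc_powr:
  assumes "p > (1::real)"
  shows "summable (\<lambda>n. (C / (1 + real n)) powr p)"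
proof -
  have "summable (\<lambda>n. real n powr (- p))" using assms by (simp add: summable_real_powr_iff)
  then have "summable (\<lambda>n. real (Suc n) powr (- p))" by (subst summable_Suc_iff)
  then have "summable (\<lambda>n. \<bar>C\<bar> powr p * real (Suc n) powr (- p))" by (rule summable_mult)
  then show ?thesis
  proof (rule summable_comparison_test'[where N = 0])
    fix n :: nat
    have "(C / (1 + real n)) powr p \<le> (\<bar>C\<bar> / (1 + real n)) powr p"
    proof (cases "C \<ge> 0")
      \<comment> \<open>The base is negative here. Since \<open>ln (- x) = ln x\<close>,
        \<open>powr\<close> sees only its absolute value.\<close>
      case False
      then have "(C / (1 + real n)) powr p = (\<bar>C\<bar> / (1 + real n)) powr p"
        by (simp add: powr_def abs_if ln_minus ln_div)
      then show ?thesis by simp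
    qed simp
    also have "\<dots> = \<bar>C\<bar> powr p * real (Suc n) powr (- p)"
      by (simp add: powr_divide powr_minus divide_simps)
    finally show "norm ((C / (1 + real n)) powr p) \<le> \<bar>C\<bar> powr p * real (Suc n) powr (- p)" by simp
  qed
qed

text \<open>Along an edge only labels active at one of its ends can change. The shares of the two
  ends are bounded by the same argument with the ends exchanged.\<close>

lemma abs_le_union_bound:
  fixes d :: "'l \<Rightarrow> real"
  assumes "finite F" "p > 0" and "\<And>l. l \<in> F \<Longrightarrow> l \<notin> P \<Longrightarrow> l \<notin> Q \<Longrightarrow> d l = 0"
    and "(\<Sum>l\<in>F \<inter> P. \<bar>d l\<bar> powr p) \<le> B" "(\<Sum>l\<in>F \<inter> Q. \<bar>d l\<bar> powr p) \<le> B"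
  shows "(\<Sum>l\<in>F. \<bar>d l\<bar> powr p) \<le> 2 * B"
proof -
  have "(\<Sum>l\<in>F. \<bar>d l\<bar> powr p) = (\<Sum>l\<in>(F \<inter> P) \<union> (F \<inter> Q). \<bar>d l\<bar> powr p)"
    by (rule sum.mono_neutral_right) (use assms in auto)
  also have "\<dots> \<le> (\<Sum>l\<in>F \<inter> P. \<bar>d l\<bar> powr p) + (\<Sum>l\<in>F \<inter> Q. \<bar>d l\<bar> powr p)"
    using sum.union_inter[of "F \<inter> P" "F \<inter> Q" "\<lambda>l. \<bar>d l\<bar> powr p"] assms(1)
    by (smt (verit) finite_Int powr_ge_zero sum_nonneg)
  finally show ?thesis using assms by linarith
qed

section \<open>Concave functions and graph distances\<close>

lemma concave_nat_increment_antimono: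
  assumes f: "concave_nat f" and "n \<le> m"
  shows "f (Suc m) - f m \<le> f (Suc n) - f n"
  using \<open>n \<le> m\<close>
proof (induction m rule: dec_induct)
  case (step k)
  have "\<And>n m. m \<le> n \<Longrightarrow> f (n + m) - f n \<le> f n - f (n - m)"
    using f by (simp add: concave_nat_def)
  from this[of 1 "Suc k"] step show ?case by simp
qed simp

text \<open>Increments decrease, so the one at \<open>n\<close> is at most the average of the first
  \<open>n\<close>, whose sum is \<open>f n - f 0\<close>.\<close>

lemma concave_nat_Suc_bound:
  assumes f: "concave_nat f" "\<And>n. 0 \<le> f n"
  shows "real n * (f (Suc n) - f n) \<le> f n"
proof -
  have "real n * (f (Suc n) - f n) = (\<Sum>k<n. f (Suc n) - f n)" by simp
  also have "\<dots> \<le> (\<Sum>k<n. f (Suc k) - f k)"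
    by (intro sum_mono concave_nat_increment_antimono[OF f(1)]) auto
  also have "\<dots> = f n - f 0" by (simp add: sum_lessThan_telescope)
  finally show ?thesis using f(2)[of 0] by linarith
qed

lemma concave_nat_divide_antimono:
  assumes f: "concave_nat f" "\<And>n. 0 \<le> f n" and "1 \<le> n" "n \<le> m"
  shows "f m / real m \<le> f n / real n"
  using \<open>n \<le> m\<close>
proof (induction m rule: dec_induct)
  case (step k)
  have "real k * f (Suc k) \<le> real (Suc k) * f k"
    using concave_nat_Suc_bound[OF f, of k] by (simp add: algebra_simps)
  then have "f (Suc k) / real (Suc k) \<le> f k / real k"
    using step assms(3) by (simp add: field_simps)
  with step show ?case by linarith
qed simp

lemma concave_nat_le_mult:
  assumes f: "concave_nat f" "\<And>n. 0 \<le> f n" and "1 \<le> n" "m \<le> c * n" "1 \<le> c"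
  shows "f m \<le> real c * f n"
proof (cases "m \<le> n")
  case True
  then have "f m \<le> f n" using f by (simp add: concave_nat_def mono_def)
  also have "\<dots> \<le> real c * f n"
    using f(2)[of n] \<open>1 \<le> c\<close> by (simp add: mult_le_cancel_right1)
  finally show ?thesis .
next
  case False
  then have "f m / real m \<le> f n / real n"
    using concave_nat_divide_antimono[OF f, of n m] assms by simp
  then have "f m \<le> (real m / real n) * f n"
    using False assms by (simp add: field_simps)
  also have "\<dots> \<le> real c * f n"
  proof (rule mult_right_mono[OF _ f(2)])
    have "real m \<le> real c * real n" using assms(4) by (metis of_nat_le_iff of_nat_mult)
    then show "real m / real n \<le> real c" using assms(3) by (simp add: field_simps)
  qed
  finally show ?thesis .
qed

text \<open>For positive \<open>n\<close> the exponent makes \<open>zeta p f n powr p\<close> a term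
  of the series in \<open>prop_Cpc\<close> (see \<open>zeta_powr\<close>), while
  \<open>zeta p f n * n\<close> equals \<open>f n / n powr (1 / p)\<close>: about \<open>n\<close>
  coordinates of that size have norm about \<open>f n\<close>.\<close>

definition zeta :: "real \<Rightarrow> (nat \<Rightarrow> real) \<Rightarrow> nat \<Rightarrow> real" where
  "zeta p f n = f n / real n powr (1 + 1 / p)"

context
  fixes p :: real and f :: "nat \<Rightarrow> real"
  assumes p: "p > 1" and f: "concave_nat f" "\<And>n. 0 \<le> f n"
begin

lemma zeta_nonneg: "0 \<le> zeta p f n"
  using f by (simp add: zeta_def)

lemma zeta_antimono:
  assumes "1 \<le> n" "n \<le> m"
  shows "zeta p f m \<le> zeta p f n"
proof -
  have eq: "zeta p f k = (f k / real k) * real k powr (- (1 / p))" if "1 \<le> k" for k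
  proof -
    have "real k powr (1 + 1 / p) = real k * real k powr (1 / p)"
      using that by (simp add: powr_add)
    then show ?thesis unfolding zeta_def by (simp add: powr_minus divide_inverse)
  qed
  have "real m powr (- (1 / p)) \<le> real n powr (- (1 / p))"
    using assms p by (intro powr_mono2') auto
  then show ?thesis
    using assms concave_nat_divide_antimono[OF f, of n m] f(2) eq[of n] eq[of m]
    by (simp only: order_trans[OF assms]) (rule mult_mono, auto)
qed

lemma powr_exponent_le_square:
  fixes r :: real
  assumes "r \<ge> 1"
  shows "r powr (1 + 1 / p) \<le> r\<^sup>2"
proof -
  have "r powr (1 + 1 / p) \<le> r powr 2" using assms p by (intro powr_mono) auto
  then show ?thesis using assms by (simp add: powr_numeral)
qed

text \<open>As \<open>f\<close> is monotone, only the denominator can make \<open>zeta\<close>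
  decay, and its exponent \<open>1 + 1 / p\<close> is below 2. The crude square keeps the later
  arithmetic polynomial.\<close>

lemma zeta_compare:
  assumes "1 \<le> n" "n \<le> m"
  shows "zeta p f n \<le> (real m / real n)\<^sup>2 * zeta p f m"
proof -
  have "f n \<le> f m" using f assms by (simp add: concave_nat_def mono_def)
  have "zeta p f n \<le> f m / real n powr (1 + 1 / p)"
    using \<open>f n \<le> f m\<close> by (simp add: zeta_def divide_right_mono)
  also have "\<dots> = (real m / real n) powr (1 + 1 / p) * zeta p f m"
    using assms by (simp add: zeta_def powr_divide)
  also have "\<dots> \<le> (real m / real n)\<^sup>2 * zeta p f m"
    using assms by (intro mult_right_mono powr_exponent_le_square zeta_nonneg) auto
  finally show ?thesis .
qed

lemma zeta_le_double:
  assumes "1 \<le> n" "1 \<le> t" "t \<le> 2 * n"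
  shows "zeta p f n \<le> 4 * zeta p f t"
proof (cases "t \<le> n")
  case True
  then show ?thesis using zeta_antimono[of t n] zeta_nonneg[of t] assms by linarith
next
  case False
  have "zeta p f n \<le> (real t / real n)\<^sup>2 * zeta p f t"
    using zeta_compare[of n t] False assms by simp
  also have "(real t / real n)\<^sup>2 \<le> 2\<^sup>2"
    using assms by (intro power_mono) (auto simp: divide_le_eq)
  then have "(real t / real n)\<^sup>2 * zeta p f t \<le> 4 * zeta p f t"
    using zeta_nonneg by (intro mult_right_mono) auto
  finally show ?thesis .
qed

text \<open>A discrete form of \<open>n * \<bar>\<zeta>'(n)\<bar> = O(\<zeta>(n))\<close>, obtained
  from \<open>zeta_compare\<close> at consecutive arguments. It absorbs a weight of size about
  \<open>n\<close> when \<open>zeta\<close> is differenced along an edge.\<close>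

lemma zeta_diff:
  assumes "1 \<le> n"
  shows "real n * \<bar>zeta p f n - zeta p f (Suc n)\<bar> \<le> 2 * zeta p f n"
proof -
  have a: "zeta p f (Suc n) \<le> zeta p f n" using zeta_antimono[of n "Suc n"] assms by simp
  have "zeta p f n \<le> (real (Suc n) / real n)\<^sup>2 * zeta p f (Suc n)"
    using zeta_compare[of n "Suc n"] assms by simp
  then have 1: "(real n)\<^sup>2 * zeta p f n \<le> (real (Suc n))\<^sup>2 * zeta p f (Suc n)"
    using assms by (simp add: power_divide field_simps)
  let ?r = "real n" and ?z = "zeta p f n" and ?w = "zeta p f (Suc n)"
  have "(?r)\<^sup>2 * (?z - ?w) \<le> (2 * ?r + 1) * ?w"
    using 1 by (simp add: algebra_simps power2_eq_square)
  then have "(?r + 1)\<^sup>2 * (?z - ?w) \<le> (2 * ?r + 1) * ?z"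
    by (simp add: algebra_simps power2_eq_square)
  moreover have "(2 * ?r + 1) * ?z \<le> 2 * (?r + 1) * ?z"
    by (intro mult_right_mono zeta_nonneg) auto
  moreover have "(?r + 1) * ((?r + 1) * (?z - ?w)) = (?r + 1)\<^sup>2 * (?z - ?w)"
    "(?r + 1) * (2 * ?z) = 2 * (?r + 1) * ?z"
    by (simp_all add: power2_eq_square mult.assoc)
  ultimately have "(?r + 1) * ((?r + 1) * (?z - ?w)) \<le> (?r + 1) * (2 * ?z)"
    by linarith
  then have "(?r + 1) * (?z - ?w) \<le> 2 * ?z" by (rule mult_left_le_imp_le) simp
  then show ?thesis using a by (simp add: algebra_simps)
qed

lemma zeta_powr: "zeta p f (Suc n) powr p = (1 / real (Suc n)) * (f (Suc n) / real (Suc n)) powr p"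
proof -
  have "(real (Suc n) powr (1 + 1 / p)) powr p = real (Suc n) powr p * real (Suc n)"
  proof -
    have "(1 + 1 / p) * p = p + 1" using p by (simp add: field_simps)
    then show ?thesis by (simp only: powr_powr) (simp add: powr_add)
  qed
  then show ?thesis using f by (simp add: zeta_def powr_divide mult_ac)
qed

lemma zeta_summable:
  assumes "summable (\<lambda>n. (1 / real (Suc n)) * (f (Suc n) / real (Suc n)) powr p)"
  shows "summable (\<lambda>n. zeta p f n powr p)"
  using assms unfolding zeta_powr[symmetric] by (subst (asm) summable_Suc_iff)

end

lemma concave_real_double:
  assumes "concave_real r" "\<forall>t\<ge>0. 0 \<le> r t" "0 \<le> s"
  shows "r (2 * s) \<le> 2 * r s"
proof -
  have "r (s + s) - r s \<le> r s - r (s - s)"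
    using assms(1,3) unfolding concave_real_def by blast
  moreover have "0 \<le> r 0" using assms(2) by simp
  ultimately show ?thesis by simp
qed

section \<open>Walks, geodesics and distances in a connected graph\<close>

locale graph =
  fixes E :: "'v \<Rightarrow> 'v \<Rightarrow> bool"
  assumes E_sym: "E x y \<Longrightarrow> E y x"
    and connected: "connected_graph E"
begin

abbreviation d :: "'v \<Rightarrow> 'v \<Rightarrow> nat" where "d \<equiv> gdist E"

lemma gdist_le_walk: "walk E xs \<Longrightarrow> d (hd xs) (last xs) \<le> length xs - 1"
  unfolding gdist_def by (rule Least_le) (auto simp: walk_def)

lemma geodesic_exists: "\<exists>g. geodesic E x y g"
proof -
  obtain xs where xs: "walk E xs" "hd xs = x" "last xs = y"
    using connected unfolding connected_graph_def by blast
  then have "\<exists>n. \<exists>xs. walk E xs \<and> hd xs = x \<and> last xs = y \<and> length xs = Suc n"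
    by (intro exI[of _ "length xs - 1"] exI[of _ xs]) (auto simp: walk_def)
  from LeastI_ex[OF this] show ?thesis unfolding geodesic_def gdist_def by blast
qed

lemma gdist_self [simp]: "d x x = 0"
  using gdist_le_walk[of "[x]"] by (simp add: walk_def)

lemma walk_append:
  assumes "walk E xs" "walk E ys" "last xs = hd ys"
  shows "walk E (xs @ tl ys)"
proof -
  have "E ((xs @ tl ys) ! k) ((xs @ tl ys) ! Suc k)" if k: "Suc k < length (xs @ tl ys)" for k
  proof -
    consider "Suc k < length xs" | "Suc k = length xs" | "Suc k > length xs" by linarith
    then show ?thesis
    proof cases
      case 1 then show ?thesis using assms(1) by (simp add: nth_append walk_def)
    next
      case 2
      then have "xs ! k = ys ! 0"
        using assms by (auto simp: walk_def hd_conv_nth last_conv_nth simp flip: 2)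
      moreover have "E (ys ! 0) (ys ! 1)" using assms(2) k 2 by (simp add: walk_def)
      ultimately show ?thesis using 2 k by (simp add: nth_append nth_tl)
    next
      case 3
      then obtain j where j: "k = length xs + j" by (metis less_Suc_eq_le le_iff_add)
      then show ?thesis using assms(2) k by (simp add: nth_append nth_tl walk_def Suc_diff_le)
    qed
  qed
  then show ?thesis using assms(1) by (simp add: walk_def)
qed

lemma walk_rev: "walk E xs \<Longrightarrow> walk E (rev xs)"
proof -
  assume w: "walk E xs"
  have "E (rev xs ! k) (rev xs ! Suc k)" if "Suc k < length xs" for k
  proof -
    define j where "j = length xs - Suc (Suc k)"
    have j: "Suc j < length xs" "length xs - Suc k = Suc j" using that by (auto simp: j_def)
    then have "E (xs ! j) (xs ! Suc j)" using w by (simp add: walk_def)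
    then show ?thesis using that E_sym j by (simp add: rev_nth j_def[symmetric])
  qed
  then show ?thesis using w by (simp add: walk_def)
qed

lemma gdist_triangle: "d x z \<le> d x y + d y z"
proof -
  obtain g h where "geodesic E x y g" "geodesic E y z h" using geodesic_exists by blast
  then have g: "walk E g" "hd g = x" "last g = y" "length g = Suc (d x y)"
    and h: "walk E h" "hd h = y" "last h = z" "length h = Suc (d y z)"
    by (auto simp: geodesic_def)
  have "last (g @ tl h) = z" using g h
    by (cases h) (auto simp: last_append walk_def)
  then show ?thesis
    using gdist_le_walk[OF walk_append[of g h]] g h by (auto simp: walk_def)
qed

lemma gdist_commute: "d x y = d y x"
proof -
  have le: "d x y \<le> d y x" for x y
  proof -
    obtain g where "geodesic E y x g" using geodesic_exists by blast
    then show ?thesis using gdist_le_walk[OF walk_rev[of g]]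
      by (auto simp: geodesic_def hd_rev last_rev walk_def)
  qed
  show ?thesis using le[of x y] le[of y x] by simp
qed

lemma gdist_eq_0 [simp]: "d x y = 0 \<longleftrightarrow> x = y"
proof
  assume 0: "d x y = 0"
  obtain g where "geodesic E x y g" using geodesic_exists by blast
  then show "x = y" using 0 by (auto simp: geodesic_def length_Suc_conv)
qed simp

lemma adjacent_gdist: "E x y \<Longrightarrow> d x y \<le> 1"
  using gdist_le_walk[of "[x, y]"] by (simp add: walk_def nth_Cons')

lemma walk_drop: "walk E g \<Longrightarrow> k < length g \<Longrightarrow> walk E (drop k g)"
  by (auto simp: walk_def)

lemma walk_take: "walk E g \<Longrightarrow> walk E (take (Suc k) g)"
  by (auto simp: walk_def)

lemma gdist_walk_nth:
  assumes "walk E g" "i \<le> j" "j < length g"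
  shows "d (g ! i) (g ! j) \<le> j - i"
proof -
  let ?h = "take (Suc (j - i)) (drop i g)"
  have "walk E ?h" using assms by (intro walk_take walk_drop) auto
  moreover have "hd ?h = g ! i" using assms by (simp add: hd_drop_conv_nth)
  moreover have "last ?h = g ! j" using assms by (subst last_conv_nth) auto
  moreover have "length ?h = Suc (j - i)" using assms by simp
  ultimately show ?thesis using gdist_le_walk[of ?h] by simp
qed

lemma geodesic_facts:
  assumes "geodesic E x y g"
  shows "walk E g" "g ! 0 = x" "g ! (d x y) = y" "length g = Suc (d x y)" "g \<noteq> []"
proof -
  show w: "walk E g" and l: "length g = Suc (d x y)" and ne: "g \<noteq> []"
    using assms by (auto simp: geodesic_def)
  show "g ! 0 = x" "g ! (d x y) = y"
    using assms hd_conv_nth[OF ne] last_conv_nth[OF ne] l by (simp_all add: geodesic_def)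
qed

text \<open>The three segments of \<open>g\<close> cut at \<open>i\<close> and \<open>j\<close> have
  lengths whose sum is \<open>d x y\<close>; by the triangle inequality none of them can be
  shortened.\<close>

lemma geodesic_nth_gdist:
  assumes g: "geodesic E x y g" and "i \<le> j" "j \<le> d x y"
  shows "d (g ! i) (g ! j) = j - i"
proof -
  note f = geodesic_facts[OF g]
  have "d x (g ! i) \<le> i" "d (g ! i) (g ! j) \<le> j - i" "d (g ! j) y \<le> d x y - j"
    using gdist_walk_nth[OF f(1), of 0 i] gdist_walk_nth[OF f(1), of i j]
      gdist_walk_nth[OF f(1), of j "d x y"] f assms by auto
  moreover have "d x y \<le> d x (g ! i) + d (g ! i) (g ! j) + d (g ! j) y"
    using gdist_triangle[of x y "g ! j"] gdist_triangle[of x "g ! j" "g ! i"] by linarith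
  ultimately show ?thesis using assms by linarith
qed

lemma geodesic_drop:
  assumes g: "geodesic E x y g" and "k \<le> d x y"
  shows "geodesic E (g ! k) y (drop k g)"
proof -
  note f = geodesic_facts[OF g]
  have "d (g ! k) y = d x y - k" using geodesic_nth_gdist[OF g, of k "d x y"] assms f by simp
  then show ?thesis using f assms walk_drop[OF f(1), of k]
    by (auto simp: geodesic_def hd_drop_conv_nth last_conv_nth)
qed

lemma gdist_Suc_iff:
  assumes "d x y = Suc n"
  obtains z where "E x z" "d z y = n"
proof -
  obtain g where g: "geodesic E x y g" using geodesic_exists by blast
  note f = geodesic_facts[OF g]
  have "E (g ! 0) (g ! 1)" using f(1) f(4) assms unfolding walk_def by simp
  moreover have "d (g ! 1) y = n"
    using geodesic_nth_gdist[OF g, of 1 "d x y"] f assms by simp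
  ultimately show ?thesis using that[of "g ! 1"] f by simp
qed

text \<open>Telescoping along a geodesic; all upper bounds below are therefore proved for edges
  only.\<close>

lemma lipschitz_from_edges:
  fixes \<Phi> :: "'v \<Rightarrow> 'l \<Rightarrow> real"
  assumes "p \<ge> 1" "\<And>x. lp_mem p (\<Phi> x)" "\<And>x y. E x y \<Longrightarrow> lp_norm p (\<lambda>l. \<Phi> x l - \<Phi> y l) \<le> C"
  shows "lp_norm p (\<lambda>l. \<Phi> x l - \<Phi> y l) \<le> C * real (d x y)"
proof (induction "d x y" arbitrary: x)
  case 0
  then show ?case by simp
next
  case (Suc n)
  from Suc.hyps(2)[symmetric] obtain z where z: "E x z" "d z y = n" by (rule gdist_Suc_iff)
  have "lp_norm p (\<lambda>l. \<Phi> x l - \<Phi> y l) \<le> lp_norm p (\<lambda>l. \<Phi> x l - \<Phi> z l) + lp_norm p (\<lambda>l. \<Phi> z l - \<Phi> y l)"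
    by (rule lp_norm_triangle) (use assms in auto)
  also have "\<dots> \<le> C + C * real (d z y)"
    using assms(3)[OF z(1)] Suc.hyps(1)[of z] z(2) by simp
  also have "\<dots> = C * real (d x y)" using Suc.hyps(2) z(2) by (simp add: algebra_simps flip: Suc.hyps(2))
  finally show ?case .
qed

lemma setdist_attained:
  assumes "S \<noteq> {}"
  obtains a where "a \<in> S" "d x a = setdist E x S"
proof -
  have "Inf (d x ` S) \<in> d x ` S" using assms by (intro Inf_nat_def1) auto
  then show ?thesis using that unfolding setdist_def by force
qed

lemma setdist_le: "a \<in> S \<Longrightarrow> setdist E x S \<le> d x a"
  unfolding setdist_def by (rule cInf_lower) auto

text \<open>For empty \<open>S\<close> both sides contain the same value \<open>Inf {}\<close>, so
  the Lipschitz bounds for the weights can apply this to any set.\<close>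

lemma setdist_triangle: "setdist E x S \<le> d x y + setdist E y S"
proof (cases "S = {}")
  case True then show ?thesis by (simp add: setdist_def)
next
  case False
  then obtain a where "a \<in> S" "d y a = setdist E y S" by (rule setdist_attained)
  then show ?thesis using setdist_le[of a S x] gdist_triangle[of x a y] by linarith
qed

end

text \<open>A vertex at distance \<open>r + 1\<close> is adjacent to one at distance
  \<open>r\<close>, so a bound \<open>N\<close> for radius \<open>r\<close> yields
  \<open>N + N * D\<close> for the next radius, independently of the centre.\<close>

lemma bounded_degree_ball:
  assumes "graph E" and "bounded_degree E"
  shows "\<exists>N::nat. \<forall>x. finite {y. gdist E x y \<le> r} \<and> card {y. gdist E x y \<le> r} \<le> N"
proof -
  interpret graph E by fact
  obtain D where D: "\<And>x. finite {y. E x y}" "\<And>x. card {y. E x y} \<le> D"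
    using assms(2) unfolding bounded_degree_def by blast
  show ?thesis
  proof (induction r)
    case 0
    then show ?case by (intro exI[of _ 1]) (auto simp: card_le_Suc0_iff_eq)
  next
    case (Suc r)
    then obtain N where N: "\<And>x. finite {y. d x y \<le> r}" "\<And>x. card {y. d x y \<le> r} \<le> N" by blast
    have sub: "{y. d x y \<le> Suc r} \<subseteq> {y. d x y \<le> r} \<union> (\<Union>z\<in>{y. d x y \<le> r}. {y. E z y})" for x
    proof
      fix y assume y: "y \<in> {y. d x y \<le> Suc r}"
      show "y \<in> {y. d x y \<le> r} \<union> (\<Union>z\<in>{y. d x y \<le> r}. {y. E z y})"
      proof (cases "d x y \<le> r")
        case False
        with y have "d y x = Suc r" by (simp add: gdist_commute)
        then obtain z where "E y z" "d z x = r" by (rule gdist_Suc_iff)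
        then show ?thesis using E_sym by (auto simp: gdist_commute)
      qed auto
    qed
    have fin: "finite ({y. d x y \<le> r} \<union> (\<Union>z\<in>{y. d x y \<le> r}. {y. E z y}))" for x
      using N D by auto
    have "card {y. d x y \<le> Suc r} \<le> N + N * D" for x
    proof -
      have "card {y. d x y \<le> Suc r} \<le> card ({y. d x y \<le> r} \<union> (\<Union>z\<in>{y. d x y \<le> r}. {y. E z y}))"
        by (rule card_mono[OF fin sub])
      also have "\<dots> \<le> card {y. d x y \<le> r} + card (\<Union>z\<in>{y. d x y \<le> r}. {y. E z y})"
        by (rule card_Un_le)
      also have "card (\<Union>z\<in>{y. d x y \<le> r}. {y. E z y}) \<le> (\<Sum>z\<in>{y. d x y \<le> r}. card {y. E z y})"
        using N by (intro card_UN_le) auto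
      also have "\<dots> \<le> (\<Sum>z\<in>{y. d x y \<le> r}. D)" by (intro sum_mono D)
      also have "\<dots> = card {y. d x y \<le> r} * D" by simp
      finally have "card {y. d x y \<le> Suc r} \<le> card {y. d x y \<le> r} + card {y. d x y \<le> r} * D"
        by simp
      also have "\<dots> \<le> N + N * D" using N(2)[of x] by (intro add_mono mult_le_mono1)
      finally show ?thesis .
    qed
    then show ?case using finite_subset[OF sub fin] by blast
  qed
qed

section \<open>Gates\<close>

lemma dom_plus_eqI:
  assumes "n < length g" "g ! n \<in> A" "\<And>m. m < n \<Longrightarrow> g ! m \<notin> A"
  shows "dom_plus g A = g ! n"
proof -
  have "(LEAST k. k < length g \<and> g ! k \<in> A) = n"
    by (rule Least_equality) (use assms in \<open>auto simp: not_less[symmetric]\<close>)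
  then show ?thesis by (simp add: dom_plus_def)
qed

text \<open>Distances are natural numbers, so (C1)--(C3) only involve the integer part \<open>k\<close> of \<open>K\<close>.\<close>

locale spqr = graph E for E :: "'v \<Rightarrow> 'v \<Rightarrow> bool" +
  fixes A :: "'i \<Rightarrow> 'v set" and I :: "'i set" and e :: 'v and K :: real and k :: nat
  assumes bounded_degree: "bounded_degree E"
    and cover: "(\<Union>i\<in>I. A i) = UNIV"
    and k_le_K: "real k \<le> K" and K_less: "K < real k + 1" and k_pos: "1 \<le> k"
    and C1: "\<And>i x1 x2 g1 g2. i \<in> I \<Longrightarrow> geodesic E x1 e g1 \<Longrightarrow> geodesic E x2 e g2 \<Longrightarrow>
      meets g1 (A i) \<Longrightarrow> meets g2 (A i) \<Longrightarrow> gdist E (dom_minus g1 (A i)) (dom_minus g2 (A i)) \<le> k"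
    and C2a: "\<And>i x y gx gy. i \<in> I \<Longrightarrow> 4 * gdist E x y \<le> setdist E x (A i) \<or> gdist E x y \<le> 1 \<Longrightarrow>
      geodesic E x e gx \<Longrightarrow> geodesic E y e gy \<Longrightarrow> meets gx (A i) \<Longrightarrow> meets gy (A i) \<Longrightarrow>
      gdist E (dom_plus gx (A i)) (dom_plus gy (A i)) \<le> k"
    and C2b: "\<And>i x y gx gy. i \<in> I \<Longrightarrow> 4 * gdist E x y \<le> setdist E x (A i) \<or> gdist E x y \<le> 1 \<Longrightarrow>
      geodesic E x e gx \<Longrightarrow> geodesic E y e gy \<Longrightarrow> meets gx (A i) \<Longrightarrow> \<not> meets gy (A i) \<Longrightarrow>
      ilen E gx (A i) \<le> k"
    and C3: "\<And>x. finite {i \<in> I. x \<in> A i}" "\<And>x. card {i \<in> I. x \<in> A i} \<le> k"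
    and C4: "\<And>x t. finite {i \<in> Ix E e A I K x. setdist E x (A i) = t}"
      "\<And>x t. card {i \<in> Ix E e A I K x. setdist E x (A i) = t} \<le> k"
begin

definition nrm :: "'v \<Rightarrow> nat" where "nrm x = d x e"

definition geo :: "'v \<Rightarrow> 'v list" where "geo x = (SOME g. geodesic E x e g)"

text \<open>By (C1) every geodesic to \<open>e\<close> that meets \<open>A i\<close> leaves it
  within \<open>k\<close> of this vertex, so the arbitrary choice matters only up to
  \<open>k\<close>.\<close>

definition base :: "'i \<Rightarrow> 'v" where "base i = dom_minus (geo (SOME a. a \<in> A i)) (A i)"

definition gate :: "'i \<Rightarrow> 'v list \<Rightarrow> 'v" where
  "gate i g = (if meets g (A i) then dom_plus g (A i) else base i)"

definition near :: "'i \<Rightarrow> 'v \<Rightarrow> 'v \<Rightarrow> bool" where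
  "near i x y \<longleftrightarrow> 5 * d x y \<le> setdist E x (A i) \<or> d x y \<le> 1"

lemma geo: "geodesic E x e (geo x)"
  unfolding geo_def using geodesic_exists by (rule someI_ex)

lemma nrm_le: "nrm x \<le> d x y + nrm y"
  using gdist_triangle[of x e y] by (simp add: nrm_def)

lemma geodesic_nth:
  assumes "geodesic E x e g" "n \<le> nrm x"
  shows "nrm (g ! n) = nrm x - n" "d x (g ! n) = n"
  using geodesic_nth_gdist[OF assms(1), of n "nrm x"] geodesic_nth_gdist[OF assms(1), of 0 n]
    geodesic_facts[OF assms(1)] assms(2) by (simp_all add: nrm_def)

lemma geodesic_index:
  assumes "geodesic E x e g" "a \<in> set g"
  obtains w where "w \<le> nrm x" "a = g ! w"
proof -
  from assms(2) obtain w where "w < length g" "g ! w = a" by (auto simp: in_set_conv_nth)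
  then show ?thesis using that[of w] geodesic_facts(4)[OF assms(1)] by (simp add: nrm_def)
qed

lemma geodesic_nth_in_set: "geodesic E x e g \<Longrightarrow> w \<le> nrm x \<Longrightarrow> g ! w \<in> set g"
  using geodesic_facts(4) by (simp add: nrm_def)

lemma geodesic_dist:
  assumes "geodesic E x e g" "a \<in> set g" "b \<in> set g" "nrm b \<le> nrm a"
  shows "d a b = nrm a - nrm b"
proof -
  obtain i j where ij: "a = g ! i" "i \<le> nrm x" "b = g ! j" "j \<le> nrm x"
    using geodesic_index[OF assms(1)] assms(2,3) by metis
  then have "i \<le> j" using assms(4) geodesic_nth[OF assms(1)] by fastforce
  then show ?thesis
    using ij geodesic_nth_gdist[OF assms(1), of i j] geodesic_nth[OF assms(1)] by (simp add: nrm_def)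
qed

lemma geodesic_start_dist:
  assumes "geodesic E x e g" "a \<in> set g"
  shows "nrm a \<le> nrm x" "d x a = nrm x - nrm a"
proof -
  obtain i where i: "a = g ! i" "i \<le> nrm x"
    using geodesic_index[OF assms] by metis
  then show "nrm a \<le> nrm x" "d x a = nrm x - nrm a"
    using geodesic_nth[OF assms(1) i(2)] by auto
qed

lemma dom_indices:
  assumes g: "geodesic E x e g" and "meets g S"
  obtains u v where "u \<le> v" "v \<le> nrm x" "dom_plus g S = g ! u" "dom_minus g S = g ! v"
    "g ! u \<in> S" "g ! v \<in> S" "\<And>w. w \<le> nrm x \<Longrightarrow> g ! w \<in> S \<Longrightarrow> u \<le> w \<and> w \<le> v"
proof -
  let ?P = "\<lambda>n. n < length g \<and> g ! n \<in> S"
  have ex: "\<exists>n. ?P n" using assms(2) unfolding meets_def by (metis in_set_conv_nth)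
  have bd: "\<And>n. ?P n \<Longrightarrow> n \<le> length g" by simp
  have len: "length g = Suc (nrm x)" using geodesic_facts[OF g] by (simp add: nrm_def)
  let ?u = "Least ?P" and ?v = "Greatest ?P"
  have "?P ?u" by (rule LeastI_ex[OF ex])
  moreover have "?P ?v" by (rule GreatestI_ex_nat[OF ex bd])
  moreover have "?u \<le> w \<and> w \<le> ?v" if "?P w" for w
    using Least_le[of ?P, OF that] Greatest_le_nat[of ?P, OF that bd] by auto
  ultimately show ?thesis
    using that[of ?u ?v] unfolding dom_plus_def dom_minus_def len less_Suc_eq_le by blast
qed

lemma dom_facts:
  assumes g: "geodesic E x e g" and "meets g S"
  shows "dom_plus g S \<in> S" "dom_plus g S \<in> set g" "dom_minus g S \<in> S" "dom_minus g S \<in> set g"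
    and "nrm (dom_minus g S) \<le> nrm (dom_plus g S)"
    and "a \<in> set g \<Longrightarrow> a \<in> S \<Longrightarrow> nrm (dom_minus g S) \<le> nrm a \<and> nrm a \<le> nrm (dom_plus g S)"
    and "ilen E g S = nrm (dom_plus g S) - nrm (dom_minus g S) + 1"
proof -
  obtain u v where uv: "u \<le> v" "v \<le> nrm x" "dom_plus g S = g ! u" "dom_minus g S = g ! v"
    "g ! u \<in> S" "g ! v \<in> S" "\<And>w. w \<le> nrm x \<Longrightarrow> g ! w \<in> S \<Longrightarrow> u \<le> w \<and> w \<le> v"
    by (rule dom_indices[OF assms]) blast
  note f = geodesic_facts[OF g] and nth = geodesic_nth[OF g]
  show 1: "dom_plus g S \<in> S" "dom_plus g S \<in> set g" "dom_minus g S \<in> S" "dom_minus g S \<in> set g"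
    using uv(1-6) geodesic_nth_in_set[OF g, of u] geodesic_nth_in_set[OF g, of v] by simp_all
  show 2: "nrm (dom_minus g S) \<le> nrm (dom_plus g S)"
    using uv(1-4) nth(1)[of u] nth(1)[of v] by simp
  show "nrm (dom_minus g S) \<le> nrm a \<and> nrm a \<le> nrm (dom_plus g S)" if a: "a \<in> set g" "a \<in> S"
  proof -
    obtain w where "w \<le> nrm x" "a = g ! w"
      using geodesic_index[OF g a(1)] by metis
    then show ?thesis using uv(1-4) uv(7)[of w] nth(1) a(2) by auto
  qed
  show "ilen E g S = nrm (dom_plus g S) - nrm (dom_minus g S) + 1"
    using geodesic_dist[OF g 1(2) 1(4) 2] by (simp add: ilen_def gdist_commute)
qed

lemma base_meets:
  assumes "A i \<noteq> {}"
  obtains x where "meets (geo x) (A i)" "base i = dom_minus (geo x) (A i)"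
proof -
  let ?a = "SOME a. a \<in> A i"
  have "?a \<in> A i" using assms by (simp add: some_in_eq)
  moreover have "?a \<in> set (geo ?a)"
    using geodesic_facts[OF geo, of ?a] by (metis nth_mem length_greater_0_conv)
  ultimately show ?thesis using that[of ?a] by (auto simp: meets_def base_def)
qed

lemma base_in: "A i \<noteq> {} \<Longrightarrow> base i \<in> A i"
  using base_meets[of i] dom_facts(3)[OF geo] by metis

lemma base_close:
  assumes "i \<in> I" "geodesic E x e g" "meets g (A i)"
  shows "d (dom_minus g (A i)) (base i) \<le> k"
proof -
  have "A i \<noteq> {}" using assms(3) by (auto simp: meets_def)
  then obtain y where "meets (geo y) (A i)" "base i = dom_minus (geo y) (A i)" by (rule base_meets)
  then show ?thesis using C1[OF assms(1,2) geo assms(3)] by simp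
qed

lemma base_height:
  assumes "i \<in> I" "geodesic E x e g" "meets g (A i)"
  shows "nrm (dom_minus g (A i)) \<le> nrm (base i) + k" "nrm (base i) \<le> nrm (dom_minus g (A i)) + k"
  using base_close[OF assms] nrm_le[of "dom_minus g (A i)" "base i"]
    nrm_le[of "base i" "dom_minus g (A i)"] gdist_commute[of "base i" "dom_minus g (A i)"] by linarith+

lemma gate_in: "A i \<noteq> {} \<Longrightarrow> geodesic E x e g \<Longrightarrow> gate i g \<in> A i"
  using base_in dom_facts(1) by (simp add: gate_def)

text \<open>\<open>near\<close> has the factor 5 instead of the 4 of (C2) so that (C2) applies from both endpoints.\<close>

lemma near_sym_cases:
  assumes "near i x y"
  shows "4 * d x y \<le> setdist E x (A i) \<or> d x y \<le> 1" "4 * d y x \<le> setdist E y (A i) \<or> d y x \<le> 1"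
  using assms setdist_triangle[of x "A i" y] unfolding near_def gdist_commute[of y x] by linarith+

lemma near_meets:
  assumes "i \<in> I" "near i x y" "geodesic E x e g" "geodesic E y e g'"
    "meets g (A i)" "meets g' (A i)"
  shows "d (dom_plus g (A i)) (dom_plus g' (A i)) \<le> k"
  using C2a[OF assms(1) near_sym_cases(1)[OF assms(2)] assms(3-6)] .

text \<open>The second half of (C2) makes the domain of \<open>g\<close> short, so its entry is
  close to its exit, and (C1) places the exit close to \<open>base i\<close>.\<close>

lemma near_not_meets:
  assumes "i \<in> I" "near i x y \<or> near i y x" "geodesic E x e g" "geodesic E y e g'"
    "meets g (A i)" "\<not> meets g' (A i)"
  shows "d (dom_plus g (A i)) (base i) < 2 * k" "nrm (dom_plus g (A i)) < nrm (base i) + 2 * k"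
    "nrm (dom_plus g (A i)) < nrm (dom_minus g (A i)) + k"
proof -
  have l: "ilen E g (A i) \<le> k"
    using C2b[OF assms(1) _ assms(3-6)] near_sym_cases[of i x y] near_sym_cases[of i y x] assms(2)
    by blast
  note f = dom_facts[OF assms(3,5)]
  have "d (dom_plus g (A i)) (dom_minus g (A i)) < k"
    using l unfolding ilen_def gdist_commute[of "dom_minus g (A i)"] by linarith
  then show 1: "d (dom_plus g (A i)) (base i) < 2 * k"
    using base_close[OF assms(1,3,5)] gdist_triangle[of "dom_plus g (A i)" "base i" "dom_minus g (A i)"]
    by linarith
  then show "nrm (dom_plus g (A i)) < nrm (base i) + 2 * k"
    using nrm_le[of "dom_plus g (A i)" "base i"] by linarith
  show "nrm (dom_plus g (A i)) < nrm (dom_minus g (A i)) + k"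
    using l f(5) f(7) by linarith
qed

lemma near_gate:
  assumes "i \<in> I" "near i x y" "geodesic E x e g" "geodesic E y e g'"
  shows "d (gate i g) (gate i g') \<le> 2 * k"
  using near_meets[OF assms] near_not_meets(1)[OF assms(1) _ assms(3,4)]
    near_not_meets(1)[OF assms(1) _ assms(4,3)] assms(2) gdist_commute[of "base i"]
  by (auto simp: gate_def intro: less_imp_le)

text \<open>If \<open>g\<close> missed the piece, \<open>near_not_meets\<close> would put the entry
  of \<open>g'\<close> less than \<open>2 * k\<close> above the base. Entries high above the base
  thus persist under \<open>near\<close>.\<close>

lemma near_far_meets:
  assumes "i \<in> I" "near i x y" "geodesic E x e g" "geodesic E y e g'"
    "meets g' (A i)" "nrm (base i) + 2 * k \<le> nrm (dom_plus g' (A i))"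
  shows "meets g (A i)" "d (dom_plus g (A i)) (dom_plus g' (A i)) \<le> k"
proof -
  show "meets g (A i)"
    using near_not_meets(2)[OF assms(1) _ assms(4,3,5)] assms(2,6) by fastforce
  then show "d (dom_plus g (A i)) (dom_plus g' (A i)) \<le> k"
    using near_meets[OF assms(1-4)] assms(5) by simp
qed

lemma gate_self:
  assumes "a \<in> A i" "geodesic E a e g"
  shows "gate i g = a" "meets g (A i)" "dom_plus g (A i) = a"
proof -
  note f = geodesic_facts[OF assms(2)]
  show 1: "meets g (A i)" using f assms(1) by (metis meets_def nth_mem length_greater_0_conv)
  show 2: "dom_plus g (A i) = a" using dom_plus_eqI[of 0 g "A i"] f assms(1) by simp
  show "gate i g = a" using 1 2 by (simp add: gate_def)
qed

text \<open>Points of \<open>A i\<close> are their own gates, and each edge on the way from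
  \<open>x\<close> to \<open>a\<close> moves the gate by at most \<open>2 * k\<close>.\<close>

lemma gate_dist_point:
  assumes "i \<in> I" "a \<in> A i" "geodesic E x e g"
  shows "d (gate i g) a \<le> 2 * k * d x a"
  using assms(3)
proof (induction "d x a" arbitrary: x g)
  case 0
  then show ?case using gate_self[OF assms(2)] by simp
next
  case (Suc n)
  from Suc.hyps(2)[symmetric] obtain z where z: "E x z" "d z a = n" by (rule gdist_Suc_iff)
  have "near i x z" using adjacent_gdist[OF z(1)] by (simp add: near_def)
  then have "d (gate i g) (gate i (geo z)) \<le> 2 * k"
    using near_gate[OF assms(1) _ Suc.prems geo] by blast
  moreover have "d (gate i (geo z)) a \<le> 2 * k * n" using Suc.hyps(1)[of z] z geo by simp
  ultimately show ?case
    using gdist_triangle[of "gate i g" a "gate i (geo z)"] Suc.hyps(2)[symmetric] by simp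
qed

text \<open>Applying \<open>gate_dist_point\<close> to a closest point of \<open>A i\<close> shows
  that the gate is itself a closest point up to a constant factor.\<close>

lemma gate_dist:
  assumes "i \<in> I" "A i \<noteq> {}" "geodesic E x e g"
  shows "d x (gate i g) \<le> (2 * k + 1) * setdist E x (A i)"
proof -
  obtain a where a: "a \<in> A i" "d x a = setdist E x (A i)" using setdist_attained[OF assms(2)] by metis
  show ?thesis
    using gate_dist_point[OF assms(1) a(1) assms(3)] gdist_triangle[of x "gate i g" a] a(2)
      gdist_commute[of a] by simp
qed

text \<open>(C2) for the two tails of \<open>g\<close> that start at a point of \<open>A\<^sub>i\<close> and at its successor bounds the
  distance between consecutive points of \<open>g \<inter> A\<^sub>i\<close>.\<close>

lemma domain_gap:
  assumes i: "i \<in> I" and g: "geodesic E x e g" and m: "meets g (A i)"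
    and h: "nrm (dom_minus g (A i)) \<le> h" "h \<le> nrm (dom_plus g (A i))"
  obtains q where "q \<in> A i" "q \<in> set g" "h \<le> nrm q" "nrm q \<le> h + k"
proof -
  obtain u v where uv: "u \<le> v" "v \<le> nrm x" "dom_plus g (A i) = g ! u" "dom_minus g (A i) = g ! v"
    "g ! u \<in> A i" "g ! v \<in> A i" "\<And>w. w \<le> nrm x \<Longrightarrow> g ! w \<in> A i \<Longrightarrow> u \<le> w \<and> w \<le> v"
    by (rule dom_indices[OF g m]) blast
  note f = geodesic_facts[OF g] and nth = geodesic_nth[OF g]
  have len: "length g = Suc (nrm x)" using f by (simp add: nrm_def)
  define s where "s = nrm x - h"
  have s: "u \<le> s" "s \<le> v" "h = nrm x - s" "s \<le> nrm x"
    using h uv(1-4) nth(1)[of u] nth(1)[of v] by (auto simp: s_def)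
  \<comment> \<open>\<open>w\<close> is the last visit to \<open>A i\<close> up to the index
    \<open>s\<close> of height \<open>h\<close>, and \<open>w'\<close> below is the next one. No
    visit lies strictly between, so the tail starting at \<open>Suc w\<close> enters
    \<open>A i\<close> at \<open>w'\<close>.\<close>
  let ?P = "\<lambda>w. w \<le> s \<and> g ! w \<in> A i"
  define w where "w = Greatest ?P"
  have "?P u" using s uv by simp
  then have w: "?P w" and wmax: "\<And>w'. ?P w' \<Longrightarrow> w' \<le> w"
    unfolding w_def by (rule GreatestI_nat[where b = s], simp) (rule Greatest_le_nat[where b = s], auto)
  have "s \<le> w + k"
  proof (cases "w = s")
    case False
    let ?Q = "\<lambda>w'. w < w' \<and> w' \<le> nrm x \<and> g ! w' \<in> A i"
    define w' where "w' = Least ?Q"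
    have "?Q v" using False w s uv by auto
    then have w': "?Q w'" and w'min: "\<And>z. ?Q z \<Longrightarrow> w' \<le> z"
      unfolding w'_def by (rule LeastI) (rule Least_le)
    have wx: "w \<le> nrm x" "Suc w \<le> nrm x" using w w' by auto
    have "s < w'" using wmax[of w'] w' by (cases "w' \<le> s") auto
    have g1: "geodesic E (g ! w) e (drop w g)" and g2: "geodesic E (g ! Suc w) e (drop (Suc w) g)"
      using geodesic_drop[OF g] wx by (simp_all add: nrm_def)
    have dp1: "dom_plus (drop w g) (A i) = g ! w"
      using dom_plus_eqI[of 0 "drop w g" "A i"] w wx len by simp
    have dp2: "dom_plus (drop (Suc w) g) (A i) = g ! w'"
    proof -
      have "drop (Suc w) g ! m \<notin> A i" if "m < w' - Suc w" for m
      proof -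
        have "Suc w + m < w'" using that by linarith
        then show ?thesis using w'min[of "Suc w + m"] w' len by auto
      qed
      moreover have "w' - Suc w < nrm x - w" using w' by linarith
      ultimately show ?thesis
        using dom_plus_eqI[of "w' - Suc w" "drop (Suc w) g" "A i"] w' len by simp
    qed
    have "g ! w \<in> set (drop w g)" using nth_mem[of 0 "drop w g"] wx len by simp
    then have m1: "meets (drop w g) (A i)" using w by (auto simp: meets_def)
    have "g ! w' \<in> set (drop (Suc w) g)" 
    proof -
      have "w' - Suc w < nrm x - w" using w' by linarith
      then show ?thesis using nth_mem[of "w' - Suc w" "drop (Suc w) g"] w' len by simp
    qed
    then have m2: "meets (drop (Suc w) g) (A i)" using w' by (auto simp: meets_def)
    have "d (g ! w) (g ! Suc w) \<le> 1" using geodesic_nth_gdist[OF g, of w "Suc w"] wx by (simp add: nrm_def)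
    then have "d (g ! w) (g ! w') \<le> k" using C2a[OF i _ g1 g2 m1 m2] dp1 dp2 by simp
    moreover have "d (g ! w) (g ! w') = w' - w"
      using geodesic_nth_gdist[OF g, of w w'] w' by (simp add: nrm_def)
    ultimately show ?thesis using \<open>s < w'\<close> by linarith
  qed simp
  then have "nrm x - s \<le> nrm x - w" "nrm x - w \<le> (nrm x - s) + k" using s(4) w by linarith+
  then show ?thesis
    using that[of "g ! w"] w s nth[of w] len by simp
qed

text \<open>A geodesic to \<open>e\<close> passes each height at most once, and (C3) bounds the
  number of pieces through a vertex.\<close>

lemma pieces_on_geodesic:
  assumes g: "geodesic E x e g" 
  shows "finite {i \<in> I. \<exists>q\<in>set g. q \<in> A i \<and> P (nrm q)}"
    and "finite H \<Longrightarrow> card {i \<in> I. \<exists>q\<in>set g. q \<in> A i \<and> nrm q \<in> H} \<le> card H * k"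
proof -
  have "{i \<in> I. \<exists>q\<in>set g. q \<in> A i \<and> P (nrm q)} \<subseteq> (\<Union>q\<in>set g. {i \<in> I. q \<in> A i})" by auto
  then show "finite {i \<in> I. \<exists>q\<in>set g. q \<in> A i \<and> P (nrm q)}"
    by (rule finite_subset) (use C3 in auto)
  assume H: "finite H"
  define r where "r h = g ! (nrm x - h)" for h
  have eq: "q = r (nrm q)" if q: "q \<in> set g" for q
  proof -
    obtain w where "w \<le> nrm x" "q = g ! w"
      using geodesic_index[OF g q] by metis
    then show ?thesis using geodesic_nth[OF g] by (simp add: r_def)
  qed
  have "{i \<in> I. \<exists>q\<in>set g. q \<in> A i \<and> nrm q \<in> H} \<subseteq> (\<Union>h\<in>H. {i \<in> I. r h \<in> A i})"
    using eq by fastforce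
  then have "card {i \<in> I. \<exists>q\<in>set g. q \<in> A i \<and> nrm q \<in> H} \<le> card (\<Union>h\<in>H. {i \<in> I. r h \<in> A i})"
    by (rule card_mono[rotated]) (use H C3 in auto)
  also have "\<dots> \<le> (\<Sum>h\<in>H. card {i \<in> I. r h \<in> A i})" using H by (rule card_UN_le)
  also have "\<dots> \<le> (\<Sum>h\<in>H. k)" by (intro sum_mono C3)
  finally show "card {i \<in> I. \<exists>q\<in>set g. q \<in> A i \<and> nrm q \<in> H} \<le> card H * k" by simp
qed

end

section \<open>Weights along geodesics\<close>

context spqr
begin

lemma adjacent_nrm: "E x y \<Longrightarrow> nrm x \<le> nrm y + 1"
  using nrm_le[of x y] adjacent_gdist[of x y] by linarith

lemma adjacent_setdist: "E x y \<Longrightarrow> setdist E x S \<le> setdist E y S + 1"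
  using setdist_triangle[of x S y] adjacent_gdist[of x y] by linarith

text \<open>The weight \<open>w x l\<close> is meant as the height difference
  \<open>nrm x - ht l\<close> already multiplied by a cut-off; hence the bound \<open>w_le\<close>
  below.\<close>

definition tent :: "real \<Rightarrow> (nat \<Rightarrow> real) \<Rightarrow> ('l \<Rightarrow> nat) \<Rightarrow> ('v \<Rightarrow> 'l \<Rightarrow> nat) \<Rightarrow> 'v \<Rightarrow> 'l \<Rightarrow> real" where
  "tent p f ht w x l = zeta p f (nrm x - ht l) * real (w x l)"

context
  fixes p :: real and f :: "nat \<Rightarrow> real" and ht :: "'l \<Rightarrow> nat" and w T :: "'v \<Rightarrow> 'l \<Rightarrow> nat"
    and B M :: nat
  assumes p: "p > 1" and f: "concave_nat f" "\<And>n. 0 \<le> f n" and sm: "summable (\<lambda>n. zeta p f n powr p)"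
    and w_le: "\<And>x l. w x l \<le> nrm x - ht l"
    and w_lip: "\<And>x y l. E x y \<Longrightarrow> w x l \<le> w y l + B"
    and T: "\<And>x l. 0 < w x l \<Longrightarrow> 1 \<le> T x l \<and> T x l \<le> 2 * (nrm x - ht l)"
    and fin: "\<And>x t. 1 \<le> t \<Longrightarrow> finite {l. 0 < w x l \<and> T x l = t}"
    and card: "\<And>x t. 1 \<le> t \<Longrightarrow> card {l. 0 < w x l \<and> T x l = t} \<le> M"
begin

text \<open>This is the product rule: the weight has bounded variation, and the variation of
  \<open>zeta\<close> is controlled by \<open>zeta_diff\<close>. \<open>T\<close> is the scale by
  which active labels are counted: the height difference for long labels, the distance to the piece
  for short ones.\<close>

lemma tent_lipschitz_pointwise:
  assumes "E x y" "0 < w x l"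
  shows "\<bar>tent p f ht w x l - tent p f ht w y l\<bar> \<le> 4 * (real B + 8) * zeta p f (T x l)"
proof -
  let ?z = "zeta p f"
  define n n' where "n = nrm x - ht l" and "n' = nrm y - ht l"
  note z0 = zeta_nonneg[OF p f]
  have n: "1 \<le> n" "w x l \<le> n" "w y l \<le> n'" using assms(2) w_le[of x l] w_le[of y l] by (auto simp: n_def n'_def)
  have nn: "n \<le> n' + 1" "n' \<le> n + 1"
    using adjacent_nrm[OF assms(1)] adjacent_nrm[OF E_sym[OF assms(1)]] by (auto simp: n_def n'_def)
  have lip: "\<bar>real (w x l) - real (w y l)\<bar> \<le> real B"
    using w_lip[OF assms(1), of l] w_lip[OF E_sym[OF assms(1)], of l] by linarith
  \<comment> \<open>The weight is at most \<open>n'\<close>, so \<open>zeta_diff\<close> applies.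
    The constant 8 comes from \<open>n = Suc n'\<close>, where passing from \<open>n'\<close> back
    to \<open>n\<close> costs a factor 4.\<close>
  have 1: "\<bar>?z n - ?z n'\<bar> * real (w y l) \<le> 8 * ?z n"
  proof -
    consider "n' = n" | "n' = Suc n" | "n = Suc n'" using nn by linarith
    then show ?thesis
    proof cases
      case 1 then show ?thesis using z0[of n] by simp
    next
      case 2
      have "\<bar>?z n - ?z n'\<bar> * real (w y l) \<le> \<bar>?z n - ?z n'\<bar> * (2 * real n)"
        using n 2 by (intro mult_left_mono) auto
      also have "\<dots> \<le> 2 * (2 * ?z n)" using zeta_diff[OF p f n(1)] 2 by (simp add: mult_ac)
      finally show ?thesis using z0[of n] by linarith
    next
      case 3
      show ?thesis
      proof (cases "n' = 0")
        case True then show ?thesis using n z0[of "Suc 0"] 3 by simp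
      next
        case False
        have "\<bar>?z n - ?z n'\<bar> * real (w y l) \<le> \<bar>?z n - ?z n'\<bar> * real n'"
          using n by (intro mult_left_mono) auto
        also have "\<dots> \<le> 2 * ?z n'" using zeta_diff[OF p f, of n'] False 3
          by (simp add: mult_ac abs_minus_commute)
        also have "\<dots> \<le> 2 * (4 * ?z n)" using zeta_le_double[OF p f, of n' n] False 3 by simp
        finally show ?thesis by simp
      qed
    qed
  qed
  have "tent p f ht w x l - tent p f ht w y l =
      ?z n * (real (w x l) - real (w y l)) + (?z n - ?z n') * real (w y l)"
    by (simp add: tent_def n_def n'_def algebra_simps)
  then have "\<bar>tent p f ht w x l - tent p f ht w y l\<bar> \<le>
      ?z n * \<bar>real (w x l) - real (w y l)\<bar> + \<bar>?z n - ?z n'\<bar> * real (w y l)"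
    using z0[of n] abs_triangle_ineq[of "?z n * (real (w x l) - real (w y l))" "(?z n - ?z n') * real (w y l)"]
    by (simp add: abs_mult)
  also have "\<dots> \<le> ?z n * real B + 8 * ?z n"
    using 1 lip z0[of n] by (intro add_mono mult_left_mono)
  also have "\<dots> = (real B + 8) * ?z n" by (simp add: algebra_simps)
  also have "\<dots> \<le> (real B + 8) * (4 * ?z (T x l))"
    using zeta_le_double[OF p f n(1), of "T x l"] T[OF assms(2)] by (intro mult_left_mono) (auto simp: n_def)
  finally show ?thesis by (simp add: algebra_simps)
qed

lemma tent_mem: "lp_mem p (tent p f ht w x)"
proof (rule lp_mem_finite_support, rule finite_subset)
  show "{l. tent p f ht w x l \<noteq> 0} \<subseteq> (\<Union>t\<in>{1..2 * nrm x}. {l. 0 < w x l \<and> T x l = t})"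
  proof
    fix l assume "l \<in> {l. tent p f ht w x l \<noteq> 0}"
    then have "0 < w x l" by (cases "w x l = 0") (auto simp: tent_def)
    with T[OF this] show "l \<in> (\<Union>t\<in>{1..2 * nrm x}. {l. 0 < w x l \<and> T x l = t})" by auto
  qed
qed (use fin in auto)

text \<open>At most \<open>M\<close> labels active at \<open>x\<close> share a value of
  \<open>T\<close>, so the pointwise bounds sum to at most \<open>M\<close> copies of the convergent
  series.\<close>

lemma tent_half_sum:
  assumes "E x y \<or> E y x" "finite F" "F \<subseteq> {l. 0 < w x l}"
  shows "(\<Sum>l\<in>F. \<bar>tent p f ht w x l - tent p f ht w y l\<bar> powr p)
    \<le> (4 * (real B + 8)) powr p * (real M * (\<Sum>n. zeta p f n powr p))"
proof -
  let ?c = "4 * (real B + 8)"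
  have "E x y" using assms(1) E_sym by blast
  have "(\<Sum>l\<in>F. \<bar>tent p f ht w x l - tent p f ht w y l\<bar> powr p) \<le> (\<Sum>l\<in>F. (?c * zeta p f (T x l)) powr p)"
    using tent_lipschitz_pointwise[OF \<open>E x y\<close>] assms(3) p by (intro sum_mono powr_mono2) auto
  also have "\<dots> = ?c powr p * (\<Sum>l\<in>F. zeta p f (T x l) powr p)"
    using zeta_nonneg[OF p f] by (simp add: powr_mult sum_distrib_left)
  also have "(\<Sum>l\<in>F. zeta p f (T x l) powr p) \<le> real M * (\<Sum>n. zeta p f n powr p)"
  proof (rule sum_fibre_le[OF assms(2) _ sm])
    fix t
    show "card {l \<in> F. T x l = t} \<le> M"
    proof (cases "t = 0")
      case True
      have "1 \<le> T x l" if "l \<in> F" for l using T[of x l] assms(3) that by auto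
      with True have "{l \<in> F. T x l = t} = {}" by fastforce
      then show ?thesis by (metis card.empty le0)
    next
      case False
      then have "card {l \<in> F. T x l = t} \<le> card {l. 0 < w x l \<and> T x l = t}"
        using assms(3) fin by (intro card_mono) auto
      then show ?thesis using card[of t x] False by linarith
    qed
  qed auto
  then have "?c powr p * (\<Sum>l\<in>F. zeta p f (T x l) powr p)
      \<le> ?c powr p * (real M * (\<Sum>n. zeta p f n powr p))"
    by (intro mult_left_mono) auto
  finally show ?thesis .
qed

lemma tent_lipschitz: "\<exists>C\<ge>0. \<forall>x y. E x y \<longrightarrow> lp_norm p (\<lambda>l. tent p f ht w x l - tent p f ht w y l) \<le> C"
proof -
  let ?B = "(4 * (real B + 8)) powr p * (real M * (\<Sum>n. zeta p f n powr p))"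
  have pos: "0 \<le> ?B" using sm by (intro mult_nonneg_nonneg suminf_nonneg) auto
  show ?thesis
  proof (intro exI conjI allI impI)
    show "0 \<le> (2 * ?B) powr (1 / p)" by simp
    fix x y assume xy: "E x y"
    show "lp_norm p (\<lambda>l. tent p f ht w x l - tent p f ht w y l) \<le> (2 * ?B) powr (1 / p)"
    proof (rule lp_norm_le)
      fix F :: "'l set" assume F: "finite F"
      have "(\<Sum>l\<in>F. \<bar>tent p f ht w x l - tent p f ht w y l\<bar> powr p) \<le> 2 * ?B"
      proof (rule abs_le_union_bound[OF F, where P = "{l. 0 < w x l}" and Q = "{l. 0 < w y l}"])
        show "(\<Sum>l\<in>F \<inter> {l. 0 < w x l}. \<bar>tent p f ht w x l - tent p f ht w y l\<bar> powr p) \<le> ?B"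
          using tent_half_sum[of x y] xy F by simp
        show "(\<Sum>l\<in>F \<inter> {l. 0 < w y l}. \<bar>tent p f ht w x l - tent p f ht w y l\<bar> powr p) \<le> ?B"
          unfolding abs_minus_commute[of "tent p f ht w x _"]
          using tent_half_sum[of y x] xy F by simp
      qed (use p in \<open>auto simp: tent_def\<close>)
      then show "(\<Sum>l\<in>F. \<bar>tent p f ht w x l - tent p f ht w y l\<bar> powr p) \<le> ((2 * ?B) powr (1 / p)) powr p"
        using p pos by (simp add: powr_powr)
    qed (use p in auto)
  qed
qed

end

section \<open>Long labels (piece, height) and short labels (piece, entry point)\<close>

definition m :: nat where "m = 20 * k + 20"

definition above :: "'i \<Rightarrow> nat \<Rightarrow> 'v set" where
  "above j h = {y. h \<le> nrm (gate j (geo y))}"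

text \<open>The weights are tents of slope \<open>m\<close> in \<open>x\<close>, written with truncated subtraction. The term
  \<open>nrm x - h\<close> is about the distance from \<open>x\<close> to the point of height \<open>h\<close>, so that a nonzero weight
  comes from a vertex whose distance to \<open>x\<close> is a small fraction of it.\<close>

definition w_long :: "'v \<Rightarrow> 'i \<times> nat \<Rightarrow> nat" where
  "w_long x = (\<lambda>(j, h). if j \<in> I \<and> A j \<noteq> {} \<and> nrm (base j) + 2 * k \<le> h \<and> above j h \<noteq> {}
     then (nrm x - h) - m * setdist E x (above j h) else 0)"

text \<open>The inequalities repeat those of \<open>bdry\<close>, with the real constant
  \<open>K\<close> instead of its integer part \<open>k\<close>, so that a vertex outside this set
  satisfies the condition there exactly.\<close>

definition bad :: "nat \<Rightarrow> 'v set" where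
  "bad h = {y. \<exists>g j. geodesic E y e g \<and> j \<in> I \<and> meets g (A j) \<and> 5 * K \<le> real (ilen E g (A j)) \<and>
     real (nrm (dom_minus g (A j))) + 2 * K \<le> real h \<and> real h \<le> real (nrm (dom_plus g (A j))) - 2 * K}"

definition enters :: "'i \<Rightarrow> 'v \<Rightarrow> 'v set" where
  "enters i a = {y. meets (geo y) (A i) \<and> dom_plus (geo y) (A i) = a}"

text \<open>The \<open>min\<close> is a second cut-off, vanishing on \<open>bad\<close>; an empty
  \<open>bad\<close> set counts as infinitely far away. The bound \<open>6 * k + 6\<close> leaves
  room for a height error of \<open>3 * k\<close> before the clause with \<open>3 * K\<close> in
  \<open>Ix\<close> is at risk.\<close>

definition w_short :: "'v \<Rightarrow> 'i \<times> 'v \<Rightarrow> nat" where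
  "w_short x = (\<lambda>(i, a). if i \<in> I \<and> 6 * k + 6 \<le> nrm a \<and> enters i a \<noteq> {}
     then (if bad (nrm a) = {} then nrm x - nrm a
           else min (nrm x - nrm a) (m * setdist E x (bad (nrm a)))) - m * setdist E x (enters i a)
     else 0)"

lemma adjacent_m_setdist: "E x y \<Longrightarrow> m * setdist E x S \<le> m * setdist E y S + m"
  using mult_le_mono2[OF adjacent_setdist[of x y S], of m] by simp

lemma w_long_lip:
  assumes "E x y"
  shows "w_long x l \<le> w_long y l + (2 * m + 1)"
proof -
  obtain j h where l: "l = (j, h)" by (cases l)
  show ?thesis
    using adjacent_nrm[OF assms] adjacent_m_setdist[OF E_sym[OF assms], of "above j h"]
    unfolding l w_long_def by auto
qed

lemma w_short_lip:
  assumes "E x y"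
  shows "w_short x l \<le> w_short y l + (2 * m + 1)"
proof -
  obtain i a where l: "l = (i, a)" by (cases l)
  show ?thesis
    using adjacent_nrm[OF assms] adjacent_m_setdist[OF E_sym[OF assms], of "enters i a"]
      adjacent_m_setdist[OF assms, of "bad (nrm a)"]
    unfolding l w_short_def by (auto simp: min_def)
qed

text \<open>For near points the entry of \<open>g'\<close> persists. Otherwise \<open>x\<close> is
  so close to \<open>A j\<close>, relative to \<open>d x y\<close>, that its gate lies within half
  of \<open>nrm x - h\<close>; here \<open>10 * (2 * k + 1) \<le> m\<close> enters.\<close>

lemma long_transfer:
  assumes i: "j \<in> I" and x: "geodesic E x e g" and y: "geodesic E y e g'" "meets g' (A j)"
    and len: "nrm (base j) + 2 * k \<le> nrm (dom_plus g' (A j))" and dist: "m * d x y < nrm x - h"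
  shows "(meets g (A j) \<and> d (dom_plus g (A j)) (dom_plus g' (A j)) \<le> k) \<or>
    nrm x + h \<le> 2 * nrm (gate j g)"
proof (cases "near j x y")
  case True
  then show ?thesis using near_far_meets[OF i True x y len] by blast
next
  case False
  then have 1: "setdist E x (A j) \<le> 5 * d x y" by (simp add: near_def)
  have "A j \<noteq> {}" using y by (auto simp: meets_def)
  then have "d x (gate j g) \<le> (2 * k + 1) * setdist E x (A j)" by (rule gate_dist[OF i _ x])
  also have "\<dots> \<le> (2 * k + 1) * (5 * d x y)" using 1 by (rule mult_le_mono2)
  finally have "2 * d x (gate j g) \<le> m * d x y" unfolding m_def by (simp add: algebra_simps)
  then show ?thesis using nrm_le[of x "gate j g"] dist by linarith
qed

text \<open>The nearest vertex of \<open>above j h\<close> witnesses the label, and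
  \<open>long_transfer\<close> carries its entry point over to \<open>geo x\<close>, losing at most
  \<open>k\<close> in height.\<close>

lemma w_long_support:
  assumes "0 < w_long x (j, h)"
  shows "j \<in> I" "nrm (base j) + 2 * k \<le> h" "h < nrm x"
    "meets (geo x) (A j)" "h \<le> nrm (dom_plus (geo x) (A j)) + k"
proof -
  have c: "j \<in> I \<and> A j \<noteq> {} \<and> nrm (base j) + 2 * k \<le> h \<and> above j h \<noteq> {}"
    using assms unfolding w_long_def by (auto split: if_splits)
  then have w: "m * setdist E x (above j h) < nrm x - h"
    using assms unfolding w_long_def by simp
  show i: "j \<in> I" and b: "nrm (base j) + 2 * k \<le> h" and "h < nrm x" using c w by auto
  obtain y where y: "y \<in> above j h" "d x y = setdist E x (above j h)"
    using setdist_attained[of "above j h" x] c by blast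
  have "h \<le> nrm (gate j (geo y))" using y by (simp add: above_def)
  \<comment> \<open>A gate at least \<open>2 * k\<close> above the base differs from the base
    because \<open>1 \<le> k\<close>, so it is a genuine entry point.\<close>
  moreover from this have my: "meets (geo y) (A j)"
    using b k_pos by (rule_tac ccontr) (simp add: gate_def)
  ultimately have h: "h \<le> nrm (dom_plus (geo y) (A j))" by (simp add: gate_def)
  from long_transfer[OF i geo[of x] geo[of y] my, of h] b h w y(2)
  consider "meets (geo x) (A j)" "d (dom_plus (geo x) (A j)) (dom_plus (geo y) (A j)) \<le> k"
    | "nrm x + h \<le> 2 * nrm (gate j (geo x))" by fastforce
  then have "meets (geo x) (A j) \<and> h \<le> nrm (dom_plus (geo x) (A j)) + k"
  proof cases
    case 1
    then show ?thesis using nrm_le[of "dom_plus (geo y) (A j)" "dom_plus (geo x) (A j)"] h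
      gdist_commute[of "dom_plus (geo y) (A j)" "dom_plus (geo x) (A j)"] by linarith
  next
    case 2
    then have "h < nrm (gate j (geo x))" using \<open>h < nrm x\<close> by linarith
    then show ?thesis using b by (auto simp: gate_def split: if_splits)
  qed
  then show "meets (geo x) (A j)" "h \<le> nrm (dom_plus (geo x) (A j)) + k" by auto
qed

text \<open>The value \<open>t\<close> fixes the height \<open>h\<close>. The piece is left at
  height at most \<open>h - k\<close> and entered at height at least \<open>h - k\<close>, so
  \<open>domain_gap\<close> finds one of its points among \<open>k + 1\<close> heights of
  \<open>geo x\<close>, each shared by at most \<open>k\<close> pieces.\<close>

lemma w_long_count:
  assumes "1 \<le> t"
  shows "finite {l. 0 < w_long x l \<and> nrm x - snd l = t}"
    and "card {l. 0 < w_long x l \<and> nrm x - snd l = t} \<le> (k + 1) * k"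
proof -
  define h where "h = nrm x - t"
  let ?J = "{i \<in> I. \<exists>q\<in>set (geo x). q \<in> A i \<and> nrm q \<in> {h - k..h}}"
  have sub: "{l. 0 < w_long x l \<and> nrm x - snd l = t} \<subseteq> (\<lambda>j. (j, h)) ` ?J"
  proof
    fix l assume "l \<in> {l. 0 < w_long x l \<and> nrm x - snd l = t}"
    moreover obtain j h' where l: "l = (j, h')" by (cases l)
    ultimately have w: "0 < w_long x (j, h')" and t: "nrm x - h' = t" by auto
    note s = w_long_support[OF w]
    have h': "h' = h" using s(3) t by (simp add: h_def)
    have "nrm (dom_minus (geo x) (A j)) \<le> h - k"
      using base_height(1)[OF s(1) geo s(4)] s(2) h' by linarith
    moreover have "h - k \<le> nrm (dom_plus (geo x) (A j))" using s(5) h' by simp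
    ultimately obtain q where q: "q \<in> A j" "q \<in> set (geo x)" "h - k \<le> nrm q" "nrm q \<le> (h - k) + k"
      using domain_gap[OF s(1) geo s(4)] by blast
    moreover have "(h - k) + k = h" using s(2) h' by simp
    ultimately show "l \<in> (\<lambda>j. (j, h)) ` ?J" using l h' s(1) by auto
  qed
  have fin: "finite ?J" by (rule pieces_on_geodesic(1)[OF geo])
  then show "finite {l. 0 < w_long x l \<and> nrm x - snd l = t}"
    by (rule finite_subset[OF sub finite_imageI])
  have "card {l. 0 < w_long x l \<and> nrm x - snd l = t} \<le> card ((\<lambda>j. (j, h)) ` ?J)"
    by (rule card_mono[OF finite_imageI[OF fin] sub])
  also have "\<dots> \<le> card ?J" by (rule card_image_le[OF fin])
  also have "\<dots> \<le> card {h - k..h} * k" by (rule pieces_on_geodesic(2)[OF geo]) simp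
  also have "\<dots> \<le> (k + 1) * k" by (intro mult_le_mono1) auto
  finally show "card {l. 0 < w_long x l \<and> nrm x - snd l = t} \<le> (k + 1) * k" .
qed

text \<open>The witness is the nearest vertex of \<open>enters i a\<close>. Since
  \<open>m * d x y\<close> also stays below \<open>m\<close> times the distance to
  \<open>bad\<close>, the whole ball of radius \<open>d x y\<close> about \<open>x\<close> avoids
  \<open>bad\<close>.\<close>

lemma w_short_support:
  assumes "0 < w_short x (i, a)"
  obtains y where "i \<in> I" "6 * k + 6 \<le> nrm a" "meets (geo y) (A i)" "dom_plus (geo y) (A i) = a"
    "m * d x y < nrm x - nrm a" "\<And>y'. d x y' \<le> d x y \<Longrightarrow> y' \<notin> bad (nrm a)"
proof -
  have c: "i \<in> I" "6 * k + 6 \<le> nrm a" "enters i a \<noteq> {}"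
    using assms unfolding w_short_def by (auto split: if_splits)
  obtain y where y: "y \<in> enters i a" "d x y = setdist E x (enters i a)"
    using setdist_attained[of "enters i a" x] c by blast
  have 1: "m * d x y < nrm x - nrm a" and 2: "bad (nrm a) \<noteq> {} \<Longrightarrow> m * d x y < m * setdist E x (bad (nrm a))"
    using assms c y(2) unfolding w_short_def by (auto split: if_splits)
  have "y' \<notin> bad (nrm a)" if "d x y' \<le> d x y" for y'
  proof
    assume "y' \<in> bad (nrm a)"
    with 2 have "m * d x y < m * setdist E x (bad (nrm a))" by blast
    then show False using setdist_le[OF \<open>y' \<in> bad (nrm a)\<close>, of x] that by simp
  qed
  then show ?thesis using that[of y] c 1 y by (auto simp: enters_def)
qed

text \<open>The distance to \<open>bad\<close> in \<open>w_short\<close> reproduces the condition in the definition of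
  \<open>\<partial>\<^sub>i\<^sup>K(G\<^bsub>x,k\<^esub>)\<close>, which makes (C4) available.\<close>

lemma w_short_Ix:
  assumes "0 < w_short x (i, a)"
  shows "i \<in> Ix E e A I K x" "1 \<le> setdist E x (A i)" "setdist E x (A i) \<le> 2 * (nrm x - nrm a)"
    "d (gate i (geo x)) a \<le> 2 * k"
proof -
  obtain y where i: "i \<in> I" and a: "6 * k + 6 \<le> nrm a" and my: "meets (geo y) (A i)"
    and dp: "dom_plus (geo y) (A i) = a" and mdist: "m * d x y < nrm x - nrm a"
    and good: "\<And>y'. d x y' \<le> d x y \<Longrightarrow> y' \<notin> bad (nrm a)"
    by (rule w_short_support[OF assms]) blast
  define c t \<tau> where "c = d x y" and "t = setdist E x (A i)" and "\<tau> = nrm x - nrm a"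
  have aA: "a \<in> A i" and "a \<in> set (geo y)" using dom_facts[OF geo my] dp by auto
  then have ya: "d y a = nrm y - nrm a" "nrm a \<le> nrm y" using geodesic_start_dist[OF geo] by auto
  have P: "20 * ((k + 1) * c) < \<tau>" using mdist by (simp add: m_def c_def \<tau>_def algebra_simps)
  have "d x a \<le> c + d y a" using gdist_triangle[of x a y] by (simp add: c_def)
  moreover have "nrm y \<le> nrm x + c" using nrm_le[of y x] by (simp add: c_def gdist_commute)
  moreover have "c \<le> (k + 1) * c" by simp
  ultimately have "d x a \<le> 2 * \<tau>" using ya P unfolding \<tau>_def by linarith
  then show "setdist E x (A i) \<le> 2 * (nrm x - nrm a)"
    using setdist_le[OF aA, of x] by (simp add: \<tau>_def)
  have "gate i (geo y) = a" using my dp by (simp add: gate_def)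
  then have "d y a \<le> (2 * k + 1) * setdist E y (A i)" using gate_dist[OF i _ geo, of y] aA by auto
  also have "\<dots> \<le> (2 * k + 1) * (c + t)"
    using setdist_triangle[of y "A i" x] by (intro mult_le_mono2) (simp add: c_def t_def gdist_commute)
  also have "\<dots> \<le> 2 * ((k + 1) * c) - c + 2 * ((k + 1) * t)" by (simp add: algebra_simps)
  \<comment> \<open>Compared with the lower bound \<open>P\<close> this leaves
    \<open>9 * c < t\<close>. So \<open>x\<close> and \<open>y\<close> are near, and
    \<open>c\<close> is an admissible radius in \<open>bdry_pt\<close>.\<close>
  finally have "\<tau> \<le> 2 * ((k + 1) * c) + 2 * ((k + 1) * t)"
    using nrm_le[of x y] ya \<open>c \<le> (k + 1) * c\<close> unfolding \<tau>_def c_def by linarith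
  with P have "(k + 1) * (9 * c) < (k + 1) * t" by (simp add: algebra_simps)
  then have ct: "9 * c < t" by (metis mult_less_cancel1)
  then show "1 \<le> setdist E x (A i)" by (simp add: t_def)
  have near: "near i x y" using ct by (simp add: near_def c_def t_def)
  show "d (gate i (geo x)) a \<le> 2 * k"
    using near_gate[OF i near geo geo] \<open>gate i (geo y) = a\<close> by simp
  have "a \<in> bdry E e A I K (Gset E e x c) i"
    unfolding bdry_def mem_Collect_eq
  proof (intro exI[of _ "geo y"] conjI ballI impI)
    show "a = dom_plus (geo y) (A i)" using dp by simp
    show "geo y \<in> Gset E e x c" using geo by (auto simp: Gset_def c_def)
    show "meets (geo y) (A i)" by (rule my)
    fix g' j assume g': "g' \<in> Gset E e x c" and j: "j \<in> I" "meets g' (A j)" "5 * K \<le> real (ilen E g' (A j))"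
    obtain y' where y': "d x y' \<le> c" "geodesic E y' e g'" using g' by (auto simp: Gset_def)
    then have "y' \<notin> bad (nrm a)" using good by (simp add: c_def)
    then show "real (gdist E e (dom_plus (geo y) (A i))) \<notin>
        {real (gdist E e (dom_minus g' (A j))) + 2 * K..real (gdist E e (dom_plus g' (A j))) - 2 * K}"
      using y'(2) j unfolding bad_def dp gdist_commute[of e] nrm_def[symmetric] by auto
  qed
  moreover have "real c \<le> real t / 4" using ct by simp
  ultimately have abd: "a \<in> bdry_pt E e A I K x i" unfolding bdry_pt_def t_def by blast
  \<comment> \<open>The last clause of \<open>Ix\<close> concerns the boundary point closest to
    \<open>e\<close>, which may come from another radius and another geodesic. Its height is
    compared with that of \<open>a\<close> through the entry of \<open>geo x\<close>, or through
    \<open>base i\<close> if \<open>geo x\<close> misses the piece.\<close>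
  then obtain a' where a': "a' \<in> bdry_pt E e A I K x i" "d e a' = setdist E e (bdry_pt E e A I K x i)"
    using setdist_attained[of "bdry_pt E e A I K x i" e] by blast
  from a'(1) obtain c' g' where c': "real c' \<le> real t / 4" "g' \<in> Gset E e x c'" "meets g' (A i)" "a' = dom_plus g' (A i)"
    unfolding bdry_pt_def bdry_def t_def by blast
  from c'(2) obtain y' where y': "d x y' \<le> c'" "geodesic E y' e g'" by (auto simp: Gset_def)
  have "4 * d x y' \<le> setdist E x (A i)" using c'(1) y'(1) unfolding t_def by linarith
  have "nrm a \<le> nrm a' + 3 * k"
  proof (cases "meets (geo x) (A i)")
    case True
    let ?b = "dom_plus (geo x) (A i)"
    have "d ?b a' \<le> k" using C2a[OF i _ geo y'(2) True c'(3)] \<open>4 * d x y' \<le> _\<close> c'(4) by blast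
    moreover have "d ?b a \<le> k" using near_meets[OF i near geo geo True my] dp by simp
    ultimately show ?thesis using nrm_le[of a ?b] nrm_le[of ?b a'] gdist_commute[of a ?b] by linarith
  next
    case False
    have "nrm a < nrm (base i) + 2 * k"
      using near_not_meets(2)[OF i _ geo geo my False] near dp by simp
    moreover have "nrm (base i) \<le> nrm a' + k"
      using base_height(2)[OF i y'(2) c'(3)] dom_facts(5)[OF y'(2) c'(3)] c'(4) by simp
    ultimately show ?thesis by linarith
  qed
  then have "3 * K \<le> real (nrm a')" using a K_less by linarith
  then show "i \<in> Ix E e A I K x"
    unfolding Ix_def using i abd a'(2) by (auto simp: nrm_def gdist_commute[of e])
qed

text \<open>(C4) bounds the pieces at a given distance, and for each of them the entry point lies in
  a ball of radius \<open>2 * k\<close> around the gate of \<open>x\<close>.\<close>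

lemma w_short_count:
  "\<exists>M. \<forall>x t. finite {l. 0 < w_short x l \<and> setdist E x (A (fst l)) = t} \<and>
    card {l. 0 < w_short x l \<and> setdist E x (A (fst l)) = t} \<le> M"
proof -
  obtain N where N: "\<And>x. finite {y. d x y \<le> 2 * k}" "\<And>x. card {y. d x y \<le> 2 * k} \<le> N"
    using bounded_degree_ball[OF graph_axioms bounded_degree] by blast
  have "finite {l. 0 < w_short x l \<and> setdist E x (A (fst l)) = t} \<and>
    card {l. 0 < w_short x l \<and> setdist E x (A (fst l)) = t} \<le> k * N" for x t
  proof -
    let ?J = "{i \<in> Ix E e A I K x. setdist E x (A i) = t}"
    let ?S = "Sigma ?J (\<lambda>i. {a. d (gate i (geo x)) a \<le> 2 * k})"
    have sub: "{l. 0 < w_short x l \<and> setdist E x (A (fst l)) = t} \<subseteq> ?S"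
      using w_short_Ix by auto
    have fin: "finite ?S" using C4 N by auto
    have "card {l. 0 < w_short x l \<and> setdist E x (A (fst l)) = t} \<le> card ?S"
      by (rule card_mono[OF fin sub])
    also have "card ?S = (\<Sum>i\<in>?J. card {a. d (gate i (geo x)) a \<le> 2 * k})"
      using C4 N by (intro card_SigmaI) auto
    also have "\<dots> \<le> (\<Sum>i\<in>?J. N)" by (intro sum_mono N)
    also have "\<dots> \<le> k * N" using C4(2)[of x t] by simp
    finally show ?thesis using finite_subset[OF sub fin] by blast
  qed
  then show ?thesis by blast
qed

section \<open>Tent functions of the two label families\<close>

lemma tent_long:
  assumes "p > 1" "concave_nat f" "\<And>n. 0 \<le> f n" "summable (\<lambda>n. zeta p f n powr p)"
  shows "lp_mem p (tent p f snd w_long x)"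
    and "\<exists>C\<ge>0. \<forall>x y. E x y \<longrightarrow> lp_norm p (\<lambda>l. tent p f snd w_long x l - tent p f snd w_long y l) \<le> C"
proof -
  have le: "w_long x l \<le> nrm x - snd l" for x l by (auto simp: w_long_def split: prod.split)
  have T: "1 \<le> nrm x - snd l \<and> nrm x - snd l \<le> 2 * (nrm x - snd l)" if "0 < w_long x l" for x l
    using w_long_support(3)[of x "fst l" "snd l"] that by simp
  show "lp_mem p (tent p f snd w_long x)"
    by (rule tent_mem[OF assms le w_long_lip T w_long_count])
  show "\<exists>C\<ge>0. \<forall>x y. E x y \<longrightarrow> lp_norm p (\<lambda>l. tent p f snd w_long x l - tent p f snd w_long y l) \<le> C"
    by (rule tent_lipschitz[OF assms le w_long_lip T w_long_count])
qed

lemma tent_short: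
  assumes "p > 1" "concave_nat f" "\<And>n. 0 \<le> f n" "summable (\<lambda>n. zeta p f n powr p)"
  shows "lp_mem p (tent p f (nrm \<circ> snd) w_short x)"
    and "\<exists>C\<ge>0. \<forall>x y. E x y \<longrightarrow>
      lp_norm p (\<lambda>l. tent p f (nrm \<circ> snd) w_short x l - tent p f (nrm \<circ> snd) w_short y l) \<le> C"
proof -
  obtain M where M: "\<And>x t. finite {l. 0 < w_short x l \<and> setdist E x (A (fst l)) = t}"
    "\<And>x t. card {l. 0 < w_short x l \<and> setdist E x (A (fst l)) = t} \<le> M"
    using w_short_count by blast
  have le: "w_short x l \<le> nrm x - (nrm \<circ> snd) l" for x l by (auto simp: w_short_def split: prod.split)
  have T: "1 \<le> setdist E x (A (fst l)) \<and> setdist E x (A (fst l)) \<le> 2 * (nrm x - (nrm \<circ> snd) l)"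
    if "0 < w_short x l" for x l
    using w_short_Ix[of x "fst l" "snd l"] that by simp
  show "lp_mem p (tent p f (nrm \<circ> snd) w_short x)"
    by (rule tent_mem[OF assms le w_short_lip T M])
  show "\<exists>C\<ge>0. \<forall>x y. E x y \<longrightarrow>
      lp_norm p (\<lambda>l. tent p f (nrm \<circ> snd) w_short x l - tent p f (nrm \<circ> snd) w_short y l) \<le> C"
    by (rule tent_lipschitz[OF assms le w_short_lip T M])
qed

end

section \<open>Averaging the given maps over gates\<close>

context spqr
begin

definition cell :: "'i \<Rightarrow> 'v \<Rightarrow> 'v set" where "cell i a = {y. gate i (geo y) = a}"

text \<open>Instead of averaging over a ball, each value \<open>a\<close> of the gate is weighted by
  how close \<open>x\<close> is to the vertices having that gate. The radius is small enough that
  vertices which count are \<open>near\<close> to \<open>x\<close>, so their gates lie within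
  \<open>2 * k\<close> of the gate of \<open>x\<close>.\<close>

definition wt :: "'i \<Rightarrow> 'v \<Rightarrow> 'v \<Rightarrow> real" where
  "wt i x a = (if cell i a = {} then 0
     else max 0 (1 + real (setdist E x (A i)) / 10 - real (setdist E x (cell i a))))"

definition gates :: "'i \<Rightarrow> 'v \<Rightarrow> 'v set" where
  "gates i x = {a \<in> A i. d (gate i (geo x)) a \<le> 2 * k}"

definition tot :: "'i \<Rightarrow> 'v \<Rightarrow> real" where "tot i x = (\<Sum>a\<in>gates i x. wt i x a)"

lemma wt_nonneg [simp]: "0 \<le> wt i x a" by (simp add: wt_def)

lemma finite_ball: "finite {y. d x y \<le> r}"
  using bounded_degree_ball[OF graph_axioms bounded_degree] by blast

lemma finite_gates: "finite (gates i x)"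
  by (rule finite_subset[OF _ finite_ball[of "gate i (geo x)" "2 * k"]]) (auto simp: gates_def)

lemma gate_in_gates: "A i \<noteq> {} \<Longrightarrow> gate i (geo x) \<in> gates i x"
  using gate_in[OF _ geo] by (simp add: gates_def)

lemma wt_support:
  assumes i: "i \<in> I" and ne: "A i \<noteq> {}" and w: "wt i x a \<noteq> 0"
  shows "a \<in> gates i x"
proof -
  have c: "cell i a \<noteq> {}" and lt: "real (setdist E x (cell i a)) < 1 + real (setdist E x (A i)) / 10"
    using w by (auto simp: wt_def split: if_splits)
  obtain y where y: "y \<in> cell i a" "d x y = setdist E x (cell i a)"
    using setdist_attained[OF c] by metis
  have "near i x y"
  proof (cases "setdist E x (A i) < 10")
    case True
    then have "real (d x y) < 2" using lt y by simp
    then show ?thesis by (simp add: near_def)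
  next
    case False
    then have "5 * real (d x y) \<le> real (setdist E x (A i))" using lt y by simp
    then show ?thesis by (simp add: near_def)
  qed
  then have "d (gate i (geo x)) (gate i (geo y)) \<le> 2 * k" using near_gate[OF i _ geo geo] by blast
  then show ?thesis using y gate_in[OF ne geo, of y] by (auto simp: cell_def gates_def)
qed

text \<open>The gate of \<open>x\<close> alone has this weight, because \<open>x\<close> lies in its
  own cell. This denominator produces the decay in \<open>mean_lip\<close>.\<close>

lemma tot_ge:
  assumes "A i \<noteq> {}"
  shows "1 + real (setdist E x (A i)) / 10 \<le> tot i x"
proof -
  have c: "x \<in> cell i (gate i (geo x))" by (simp add: cell_def)
  then have "setdist E x (cell i (gate i (geo x))) = 0" using setdist_le[OF c, of x] by simp
  with c have "1 + real (setdist E x (A i)) / 10 \<le> wt i x (gate i (geo x))"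
    by (auto simp: wt_def)
  also have "\<dots> \<le> tot i x" unfolding tot_def
    using member_le_sum[of "gate i (geo x)" "gates i x" "wt i x"] gate_in_gates[OF assms] finite_gates by simp
  finally show ?thesis .
qed

lemma tot_pos: "A i \<noteq> {} \<Longrightarrow> 0 < tot i x"
  using tot_ge[of i x] by (smt (verit) divide_nonneg_nonneg of_nat_0_le_iff)

lemma tot_superset:
  assumes "i \<in> I" "A i \<noteq> {}" "finite S" "gates i x \<subseteq> S"
  shows "tot i x = (\<Sum>a\<in>S. wt i x a)"
  unfolding tot_def by (rule sum.mono_neutral_left) (use assms(3,4) wt_support[OF assms(1,2)] in auto)

lemma wt_lip:
  assumes "E x y"
  shows "\<bar>wt i x a - wt i y a\<bar> \<le> 2"
  using adjacent_setdist[OF assms, of "A i"] adjacent_setdist[OF assms, of "cell i a"]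
    adjacent_setdist[OF E_sym[OF assms], of "A i"] adjacent_setdist[OF E_sym[OF assms], of "cell i a"]
  unfolding wt_def by auto

context
  fixes p :: real and \<psi> :: "'i \<Rightarrow> 'v \<Rightarrow> 'w \<Rightarrow> real"
  assumes p: "p > 1"
    and \<psi>_mem: "\<And>i a. i \<in> I \<Longrightarrow> a \<in> A i \<Longrightarrow> lp_mem p (\<psi> i a)"
    and \<psi>_lip: "\<And>i a b. i \<in> I \<Longrightarrow> a \<in> A i \<Longrightarrow> b \<in> A i \<Longrightarrow> lp_norm p (\<lambda>w. \<psi> i a w - \<psi> i b w) \<le> real (d a b)"
begin

text \<open>The jump of \<open>trunc\<close> is harmless since it is only compared up to additive constants; the
  truncation makes \<open>mean i x\<close> vanish for every piece that the geodesic from \<open>x\<close> misses.\<close>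

definition trunc :: "'i \<Rightarrow> 'v \<Rightarrow> 'w \<Rightarrow> real" where
  "trunc i a w = (if d a (base i) \<le> 2 * k then 0 else \<psi> i a w - \<psi> i (base i) w)"

definition mean :: "'i \<Rightarrow> 'v \<Rightarrow> 'w \<Rightarrow> real" where
  "mean i x w = (\<Sum>a\<in>gates i x. wt i x a / tot i x * trunc i a w)"

lemma p1: "1 \<le> p" and p0: "0 < p" using p by auto

lemma trunc_mem:
  assumes "i \<in> I" "a \<in> A i"
  shows "lp_mem p (trunc i a)"
proof -
  have "base i \<in> A i" using assms base_in by blast
  then show ?thesis unfolding trunc_def using lp_diff(1)[OF p1] \<psi>_mem assms
    by (cases "d a (base i) \<le> 2 * k") auto
qed

text \<open>Truncation treats a point within \<open>2 * k\<close> of the base as if it were the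
  base, which costs at most \<open>2 * k\<close> for each argument.\<close>

lemma trunc_diff:
  assumes "i \<in> I" "a \<in> A i" "b \<in> A i"
  shows "lp_norm p (\<lambda>w. trunc i a w - trunc i b w) \<le> real (d a b) + 2 * real k"
    and "lp_norm p (\<lambda>w. \<psi> i a w - \<psi> i b w) \<le> lp_norm p (\<lambda>w. trunc i a w - trunc i b w) + 4 * real k"
proof -
  let ?o = "base i"
  let ?n = "\<lambda>a b. lp_norm p (\<lambda>w. \<psi> i a w - \<psi> i b w)"
  let ?t = "lp_norm p (\<lambda>w. trunc i a w - trunc i b w)"
  have o: "?o \<in> A i" using assms base_in by blast
  have lip: "?n a b \<le> real (d a b)" "?n a ?o \<le> real (d a ?o)" "?n b ?o \<le> real (d b ?o)"
    "?n ?o a \<le> real (d a ?o)" "?n ?o b \<le> real (d b ?o)"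
    using \<psi>_lip[OF assms(1)] assms o gdist_commute[of ?o] by metis+
  have tri: "?n a b \<le> ?n a ?o + ?n ?o b"
    by (rule lp_norm_triangle[OF p1]) (use assms o \<psi>_mem in auto)
  have dt: "d a b \<le> d a ?o + d b ?o" "d a ?o \<le> d a b + d b ?o" "d b ?o \<le> d a b + d a ?o"
    using gdist_triangle[of a b ?o] gdist_triangle[of a ?o b] gdist_triangle[of b ?o a]
      gdist_commute[of ?o b] gdist_commute[of b a] by simp_all
  have drt: "real (d a b) \<le> real (d a ?o) + real (d b ?o)" "real (d a ?o) \<le> real (d a b) + real (d b ?o)"
    "real (d b ?o) \<le> real (d a b) + real (d a ?o)"
    using dt by linarith+
  consider "d a ?o \<le> 2 * k" "d b ?o \<le> 2 * k" | "d a ?o \<le> 2 * k" "\<not> d b ?o \<le> 2 * k"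
    | "\<not> d a ?o \<le> 2 * k" "d b ?o \<le> 2 * k" | "\<not> d a ?o \<le> 2 * k" "\<not> d b ?o \<le> 2 * k" by blast
  then have "?t \<le> real (d a b) + 2 * real k \<and> ?n a b \<le> ?t + 4 * real k"
  proof cases
    case 1
    then have "?t = 0" "real (d a ?o) \<le> 2 * real k" "real (d b ?o) \<le> 2 * real k"
      by (simp_all add: trunc_def)
    then show ?thesis using lip drt by simp
  next
    case 2
    then have "?t = ?n ?o b" "real (d a ?o) \<le> 2 * real k" by (simp_all add: trunc_def)
    then show ?thesis using lip drt tri by linarith
  next
    case 3
    then have "?t = ?n a ?o" "real (d b ?o) \<le> 2 * real k" by (simp_all add: trunc_def)
    then show ?thesis using lip drt tri by linarith
  next
    case 4
    then have "?t = ?n a b" by (simp add: trunc_def)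
    then show ?thesis using lip by simp
  qed
  then show "?t \<le> real (d a b) + 2 * real k" "?n a b \<le> ?t + 4 * real k" by auto
qed

lemma mean_superset:
  assumes "i \<in> I" "A i \<noteq> {}" "finite S" "gates i x \<subseteq> S"
  shows "mean i x w = (\<Sum>a\<in>S. wt i x a / tot i x * trunc i a w)"
  unfolding mean_def by (rule sum.mono_neutral_left) (use assms(3,4) wt_support[OF assms(1,2)] in auto)

lemma mean_mem:
  assumes "i \<in> I"
  shows "lp_mem p (mean i x)"
  unfolding mean_def[abs_def]
  by (rule lp_sum(1)[OF p1 finite_gates]) (use trunc_mem[OF assms] in \<open>auto simp: gates_def\<close>)

lemma mean_weights_sum:
  assumes "i \<in> I" "A i \<noteq> {}" "finite S" "gates i x \<subseteq> S"
  shows "(\<Sum>a\<in>S. wt i x a / tot i x) = 1"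
  using tot_superset[OF assms] tot_pos[OF assms(2), of x] by (simp add: sum_divide_distrib[symmetric])

text \<open>The mean is a convex combination of values at points within \<open>2 * k\<close> of the
  gate, to which \<open>trunc_diff\<close> applies.\<close>

lemma mean_close:
  assumes "i \<in> I" "A i \<noteq> {}"
  shows "lp_norm p (\<lambda>w. mean i x w - trunc i (gate i (geo x)) w) \<le> 4 * real k"
proof -
  let ?c = "gate i (geo x)"
  have c: "?c \<in> A i" using gate_in[OF assms(2) geo] .
  note s1 = mean_weights_sum[OF assms finite_gates order_refl, of x]
  have eq: "(\<lambda>w. mean i x w - trunc i ?c w)
      = (\<lambda>w. \<Sum>a\<in>gates i x. wt i x a / tot i x * (trunc i a w - trunc i ?c w))"
  proof
    fix w
    have "trunc i ?c w = (\<Sum>a\<in>gates i x. wt i x a / tot i x) * trunc i ?c w" using s1 by simp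
    then show "mean i x w - trunc i ?c w = (\<Sum>a\<in>gates i x. wt i x a / tot i x * (trunc i a w - trunc i ?c w))"
      unfolding mean_def by (simp add: right_diff_distrib sum_subtractf sum_distrib_right)
  qed
  have "lp_norm p (\<lambda>w. mean i x w - trunc i ?c w)
      \<le> (\<Sum>a\<in>gates i x. \<bar>wt i x a / tot i x\<bar> * lp_norm p (\<lambda>w. trunc i a w - trunc i ?c w))"
    unfolding eq using lp_diff(1)[OF p1] trunc_mem[OF assms(1)] c
    by (intro lp_sum(2)[OF p1 finite_gates]) (auto simp: gates_def)
  also have "\<dots> \<le> (\<Sum>a\<in>gates i x. wt i x a / tot i x * (4 * real k))"
  proof (rule sum_mono)
    fix a assume a: "a \<in> gates i x"
    then have "real (d a ?c) \<le> 2 * real k" by (simp add: gates_def gdist_commute[of a])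
    then have "lp_norm p (\<lambda>w. trunc i a w - trunc i ?c w) \<le> 4 * real k"
      using trunc_diff(1)[OF assms(1), of a ?c] a c by (simp add: gates_def)
    then show "\<bar>wt i x a / tot i x\<bar> * lp_norm p (\<lambda>w. trunc i a w - trunc i ?c w)
        \<le> wt i x a / tot i x * (4 * real k)"
      using tot_pos[OF assms(2), of x] by (simp add: mult_left_mono divide_right_mono abs_of_pos)
  qed
  also have "\<dots> = 4 * real k" by (simp only: sum_distrib_right[symmetric] s1 mult_1)
  finally show ?thesis .
qed

text \<open>Both weight families sum to 1 on \<open>S\<close>, so the value at the gate of
  \<open>x\<close> can be subtracted, leaving vectors of norm at most \<open>6 * k\<close>. The
  normalised weights change by a bounded amount divided by \<open>tot i x\<close>.\<close>

lemma mean_lip: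
  assumes N: "\<And>x. card {y. d x y \<le> 4 * k} \<le> N"
    and i: "i \<in> I" "A i \<noteq> {}" and xy: "E x y"
  shows "lp_norm p (\<lambda>w. mean i x w - mean i y w)
    \<le> (12 * real k * real N * (real N + 1)) / (1 + real (setdist E x (A i)) / 10)"
proof -
  let ?c = "gate i (geo x)" and ?R = "1 + real (setdist E x (A i)) / 10"
  define S where "S = {a \<in> A i. d ?c a \<le> 4 * k}"
  have c: "?c \<in> A i" using gate_in[OF i(2) geo] .
  have fS: "finite S" by (rule finite_subset[OF _ finite_ball[of ?c "4 * k"]]) (auto simp: S_def)
  have cS: "card S \<le> N"
    using card_mono[OF finite_ball[of ?c "4 * k"], of S] N[of ?c] by (force simp: S_def)
  have "near i x y" using adjacent_gdist[OF xy] by (simp add: near_def)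
  then have "d ?c (gate i (geo y)) \<le> 2 * k" by (rule near_gate[OF i(1) _ geo geo])
  then have sub: "gates i x \<subseteq> S" "gates i y \<subseteq> S"
  proof -
    show "gates i x \<subseteq> S" by (auto simp: gates_def S_def)
    show "gates i y \<subseteq> S"
    proof
      fix a assume a: "a \<in> gates i y"
      then show "a \<in> S" using gdist_triangle[of ?c a "gate i (geo y)"] \<open>d ?c (gate i (geo y)) \<le> 2 * k\<close>
        by (simp add: gates_def S_def)
    qed
  qed
  define \<mu> where "\<mu> z a = wt i z a / tot i z" for z a
  have s: "(\<Sum>a\<in>S. \<mu> x a) = 1" "(\<Sum>a\<in>S. \<mu> y a) = 1"
    using mean_weights_sum[OF i fS] sub by (simp_all add: \<mu>_def)
  have eq: "(\<lambda>w. mean i x w - mean i y w) = (\<lambda>w. \<Sum>a\<in>S. (\<mu> x a - \<mu> y a) * (trunc i a w - trunc i ?c w))"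
  proof
    fix w
    have "(\<Sum>a\<in>S. (\<mu> x a - \<mu> y a) * (trunc i a w - trunc i ?c w))
        = (\<Sum>a\<in>S. \<mu> x a * trunc i a w) - (\<Sum>a\<in>S. \<mu> y a * trunc i a w)
          - ((\<Sum>a\<in>S. \<mu> x a) - (\<Sum>a\<in>S. \<mu> y a)) * trunc i ?c w"
      by (simp add: algebra_simps sum_subtractf sum.distrib sum_distrib_right sum_distrib_left)
    then show "mean i x w - mean i y w = (\<Sum>a\<in>S. (\<mu> x a - \<mu> y a) * (trunc i a w - trunc i ?c w))"
      using s mean_superset[OF i fS sub(1)] mean_superset[OF i fS sub(2)] by (simp add: \<mu>_def)
  qed
  have pos: "0 < tot i x" "0 < tot i y" "0 < ?R" using tot_pos[OF i(2)] by (auto simp: add_pos_nonneg)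
  have \<mu>: "\<bar>\<mu> x a - \<mu> y a\<bar> \<le> 2 * (real N + 1) / ?R" if a: "a \<in> S" for a
  proof -
    let ?M = "tot i x" and ?M' = "tot i y"
    have "\<bar>?M - ?M'\<bar> = \<bar>\<Sum>a\<in>S. wt i x a - wt i y a\<bar>"
      using tot_superset[OF i fS] sub by (simp add: sum_subtractf)
    also have "\<dots> \<le> (\<Sum>a\<in>S. \<bar>wt i x a - wt i y a\<bar>)" by (rule sum_abs)
    also have "\<dots> \<le> (\<Sum>a\<in>S. 2)" by (intro sum_mono wt_lip[OF xy])
    also have "\<dots> \<le> 2 * real N" using cS by simp
    finally have MM: "\<bar>?M - ?M'\<bar> \<le> 2 * real N" .
    have "\<mu> y a \<le> (\<Sum>a\<in>S. \<mu> y a)"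
      using a fS pos by (intro member_le_sum) (auto simp: \<mu>_def)
    then have \<mu>1: "0 \<le> \<mu> y a" "\<mu> y a \<le> 1" using s pos by (auto simp: \<mu>_def)
    \<comment> \<open>Quotient rule, arranged so that only the total at \<open>x\<close> is divided
      by.\<close>
    have "\<mu> x a - \<mu> y a = ((wt i x a - wt i y a) - \<mu> y a * (?M - ?M')) / ?M"
      using pos by (simp add: \<mu>_def field_simps)
    then have "\<bar>\<mu> x a - \<mu> y a\<bar> = \<bar>(wt i x a - wt i y a) - \<mu> y a * (?M - ?M')\<bar> / ?M"
      using pos by simp
    also have "\<dots> \<le> (2 + 1 * (2 * real N)) / ?M"
    proof (rule divide_right_mono)
      have "\<bar>\<mu> y a * (?M - ?M')\<bar> \<le> 1 * (2 * real N)"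
        unfolding abs_mult using \<mu>1 MM by (intro mult_mono) auto
      then show "\<bar>(wt i x a - wt i y a) - \<mu> y a * (?M - ?M')\<bar> \<le> 2 + 1 * (2 * real N)"
        using wt_lip[OF xy, of i a] by linarith
    qed (use pos in simp)
    also have "\<dots> \<le> (2 + 1 * (2 * real N)) / ?R"
      using tot_ge[OF i(2), of x] pos by (intro divide_left_mono) auto
    finally show ?thesis by (simp add: algebra_simps)
  qed
  have "lp_norm p (\<lambda>w. mean i x w - mean i y w)
      \<le> (\<Sum>a\<in>S. \<bar>\<mu> x a - \<mu> y a\<bar> * lp_norm p (\<lambda>w. trunc i a w - trunc i ?c w))"
    unfolding eq using lp_diff(1)[OF p1] trunc_mem[OF i(1)] c
    by (intro lp_sum(2)[OF p1 fS]) (auto simp: S_def)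
  also have "\<dots> \<le> (\<Sum>a\<in>S. 2 * (real N + 1) / ?R * (6 * real k))"
  proof (intro sum_mono mult_mono \<mu>)
    fix a assume a: "a \<in> S"
    then have "real (d a ?c) \<le> 4 * real k" by (simp add: S_def gdist_commute[of a])
    then show "lp_norm p (\<lambda>w. trunc i a w - trunc i ?c w) \<le> 6 * real k"
      using trunc_diff(1)[OF i(1), of a ?c] a c by (simp add: S_def)
  qed (use pos in auto)
  also have "\<dots> = real (card S) * (2 * (real N + 1) / ?R * (6 * real k))" by simp
  also have "\<dots> \<le> real N * (2 * (real N + 1) / ?R * (6 * real k))"
    using cS pos by (intro mult_right_mono) auto
  also have "\<dots> = (12 * real k * real N * (real N + 1)) / ?R" by (simp add: mult_ac)
  finally show ?thesis .
qed

lemma mean_zero: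
  assumes "\<not> meets (geo x) (A i)"
  shows "mean i x w = 0"
  unfolding mean_def
  by (rule sum.neutral) (use assms in \<open>auto simp: gates_def gate_def trunc_def gdist_commute[of "base i"]\<close>)

section \<open>Assembling the averages into one map\<close>

definition pmap :: "'v \<Rightarrow> 'i \<times> 'w \<Rightarrow> real" where
  "pmap x = (\<lambda>(i, w). if i \<in> I then mean i x w else 0)"

definition met :: "'v \<Rightarrow> 'i set" where "met x = {i \<in> I. meets (geo x) (A i)}"

lemma finite_met: "finite (met x)"
  using pieces_on_geodesic(1)[OF geo, of x "\<lambda>_. True"] by (simp add: met_def meets_def)

lemma pmap_mem: "lp_mem p (pmap x)"
proof -
  let ?u = "\<lambda>i w. if i \<in> I then mean i x w else 0"
  have "(\<Sum>l\<in>F. \<bar>pmap x l\<bar> powr p) \<le> (\<Sum>i\<in>met x. lp_norm p (?u i) powr p)" if "finite F" for F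
    unfolding pmap_def
    by (rule lp_slices[OF p0 finite_met _ _ that]) (use mean_mem mean_zero in \<open>auto simp: met_def\<close>)
  then show ?thesis by (rule lp_mem_bdd)
qed

text \<open>Sorted by the distance from \<open>x\<close> to the entry point, at most
  \<open>k\<close> pieces share a value. By \<open>gate_dist\<close> this distance is at most a
  multiple of the distance to the piece, and the resulting series converges because
  \<open>p > 1\<close>.\<close>

lemma met_sum:
  assumes "C \<ge> 0"
  shows "(\<Sum>i\<in>met x. (C / (1 + real (setdist E x (A i)) / 10)) powr p)
    \<le> real k * (\<Sum>n. ((10 * (2 * real k + 1) * C) / (1 + real n)) powr p)"
proof -
  let ?T = "\<lambda>i. nrm x - nrm (dom_plus (geo x) (A i))" and ?C = "10 * (2 * real k + 1) * C"
  have "(\<Sum>i\<in>met x. (C / (1 + real (setdist E x (A i)) / 10)) powr p)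
      \<le> (\<Sum>i\<in>met x. (?C / (1 + real (?T i))) powr p)"
  proof (intro sum_mono powr_mono2)
    fix i assume i: "i \<in> met x"
    let ?t = "real (setdist E x (A i))"
    have mi: "i \<in> I" "meets (geo x) (A i)" using i by (auto simp: met_def)
    then have "A i \<noteq> {}" by (auto simp: meets_def)
    then have "?T i \<le> (2 * k + 1) * setdist E x (A i)"
      using gate_dist[OF mi(1) _ geo, of x] geodesic_start_dist(2)[OF geo dom_facts(2)[OF geo mi(2)]] mi(2)
      by (simp add: gate_def)
    then have "real (?T i) \<le> real ((2 * k + 1) * setdist E x (A i))" by (rule of_nat_mono)
    then have "1 + real (?T i) \<le> 10 * (2 * real k + 1) * (1 + ?t / 10)"
      by (simp add: algebra_simps)
    then have "C * (1 + real (?T i)) \<le> C * (10 * (2 * real k + 1) * (1 + ?t / 10))"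
      using assms by (rule mult_left_mono)
    moreover have "0 < 1 + ?t / 10" by (simp add: add_pos_nonneg)
    ultimately show "C / (1 + ?t / 10) \<le> ?C / (1 + real (?T i))"
      by (simp add: divide_le_eq pos_le_divide_eq mult_ac)
  qed (use assms p in auto)
  also have "\<dots> \<le> real k * (\<Sum>n. (?C / (1 + real n)) powr p)"
  proof (rule sum_fibre_le[OF finite_met _ summable_inverse_Suc_powr[OF p], where T = ?T])
    fix t
    have "card {i \<in> met x. ?T i = t} \<le> card {i \<in> I. \<exists>q\<in>set (geo x). q \<in> A i \<and> nrm q \<in> {nrm x - t}}"
    proof (rule card_mono)
      show "finite {i \<in> I. \<exists>q\<in>set (geo x). q \<in> A i \<and> nrm q \<in> {nrm x - t}}"
        by (rule pieces_on_geodesic(1)[OF geo])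
      show "{i \<in> met x. ?T i = t} \<subseteq> {i \<in> I. \<exists>q\<in>set (geo x). q \<in> A i \<and> nrm q \<in> {nrm x - t}}"
      proof
        fix i assume i: "i \<in> {i \<in> met x. ?T i = t}"
        then have mi: "i \<in> I" "meets (geo x) (A i)" "?T i = t" by (auto simp: met_def)
        note f = dom_facts(1,2)[OF geo mi(2)]
        have "nrm (dom_plus (geo x) (A i)) = nrm x - t"
          using mi(3) geodesic_start_dist(1)[OF geo f(2)] by linarith
        then show "i \<in> {i \<in> I. \<exists>q\<in>set (geo x). q \<in> A i \<and> nrm q \<in> {nrm x - t}}"
          using f mi(1) by auto
      qed
    qed
    also have "\<dots> \<le> card {nrm x - t} * k" by (rule pieces_on_geodesic(2)[OF geo]) simp
    finally show "card {i \<in> met x. ?T i = t} \<le> k" by simp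
  qed auto
  finally show ?thesis .
qed

lemma pmap_lip: "\<exists>C\<ge>0. \<forall>x y. E x y \<longrightarrow> lp_norm p (\<lambda>l. pmap x l - pmap y l) \<le> C"
proof -
  obtain N where N: "\<And>x. card {y. d x y \<le> 4 * k} \<le> N"
    using bounded_degree_ball[OF graph_axioms bounded_degree] by blast
  define C where "C = 12 * real k * real N * (real N + 1)"
  have C: "0 \<le> C" by (simp add: C_def)
  define B where "B = real k * (\<Sum>n. ((10 * (2 * real k + 1) * C) / (1 + real n)) powr p)"
  have B: "0 \<le> B" unfolding B_def
    by (intro mult_nonneg_nonneg suminf_nonneg summable_inverse_Suc_powr[OF p]) auto
  have half: "(\<Sum>i\<in>met x. lp_norm p (\<lambda>w. mean i x w - mean i y w) powr p) \<le> B" if xy: "E x y" for x y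
  proof -
    have "(\<Sum>i\<in>met x. lp_norm p (\<lambda>w. mean i x w - mean i y w) powr p)
        \<le> (\<Sum>i\<in>met x. (C / (1 + real (setdist E x (A i)) / 10)) powr p)"
    proof (intro sum_mono powr_mono2)
      fix i assume "i \<in> met x"
      then have "i \<in> I" "A i \<noteq> {}" by (auto simp: met_def meets_def)
      then show "lp_norm p (\<lambda>w. mean i x w - mean i y w) \<le> C / (1 + real (setdist E x (A i)) / 10)"
        unfolding C_def by (rule mean_lip[OF N _ _ xy])
    qed (use p in auto)
    also have "\<dots> \<le> B" unfolding B_def by (rule met_sum[OF C])
    finally show ?thesis .
  qed
  show ?thesis
  proof (intro exI conjI allI impI)
    show "0 \<le> (2 * B) powr (1 / p)" by simp
    fix x y assume xy: "E x y"
    show "lp_norm p (\<lambda>l. pmap x l - pmap y l) \<le> (2 * B) powr (1 / p)"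
    proof (rule lp_norm_le)
      fix F :: "('i \<times> 'w) set" assume F: "finite F"
      let ?u = "\<lambda>i w. if i \<in> I then mean i x w - mean i y w else 0"
      let ?n = "\<lambda>i. lp_norm p (\<lambda>w. mean i x w - mean i y w)"
      have "(\<Sum>l\<in>F. \<bar>pmap x l - pmap y l\<bar> powr p) = (\<Sum>l\<in>F. \<bar>case_prod ?u l\<bar> powr p)"
        by (intro sum.cong) (auto simp: pmap_def)
      also have "\<dots> \<le> (\<Sum>i\<in>met x \<union> met y. lp_norm p (?u i) powr p)"
      proof (rule lp_slices[OF p0 _ _ _ F])
        show "lp_mem p (?u i)" if "i \<in> met x \<union> met y" for i
          using that lp_diff(1)[OF p1 mean_mem mean_mem, of i i x y] by (auto simp: met_def)
      qed (use finite_met mean_zero in \<open>auto simp: met_def\<close>)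
      also have "\<dots> = (\<Sum>i\<in>met x \<union> met y. \<bar>?n i\<bar> powr p)"
        by (intro sum.cong) (auto simp: met_def)
      also have "\<dots> \<le> 2 * B"
      proof (rule abs_le_union_bound[where P = "met x" and Q = "met y"])
        have 1: "(met x \<union> met y) \<inter> met x = met x" "(met x \<union> met y) \<inter> met y = met y" by auto
        show "(\<Sum>i\<in>(met x \<union> met y) \<inter> met x. \<bar>?n i\<bar> powr p) \<le> B"
          using half[OF xy] 1 by simp
        show "(\<Sum>i\<in>(met x \<union> met y) \<inter> met y. \<bar>?n i\<bar> powr p) \<le> B"
          using half[OF E_sym[OF xy]] 1 by (simp add: lp_norm_diff_commute[of p "mean _ x"])
      qed (use finite_met p in auto)
      also have "2 * B = ((2 * B) powr (1 / p)) powr p" using p B by (simp add: powr_powr)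
      finally show "(\<Sum>l\<in>F. \<bar>pmap x l - pmap y l\<bar> powr p) \<le> ((2 * B) powr (1 / p)) powr p" .
    qed (use p in auto)
  qed
qed

text \<open>A single slice suffices. Replacing the means by truncated values costs
  \<open>8 * k\<close>, and undoing the truncation \<open>4 * k\<close>.\<close>

lemma pmap_lower:
  assumes "i \<in> I" "A i \<noteq> {}"
  shows "lp_norm p (\<lambda>w. \<psi> i (gate i (geo x)) w - \<psi> i (gate i (geo y)) w)
    \<le> lp_norm p (\<lambda>l. pmap x l - pmap y l) + 12 * real k"
proof -
  let ?a = "gate i (geo x)" and ?b = "gate i (geo y)"
  have ab: "?a \<in> A i" "?b \<in> A i" using gate_in[OF assms(2) geo] by auto
  note mem = trunc_mem[OF assms(1) ab(1)] trunc_mem[OF assms(1) ab(2)] mean_mem[OF assms(1)]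
  have "lp_norm p (\<lambda>w. trunc i ?a w - trunc i ?b w)
      \<le> lp_norm p (\<lambda>w. trunc i ?a w - mean i x w) + lp_norm p (\<lambda>w. mean i x w - trunc i ?b w)"
    by (rule lp_norm_triangle[OF p1]) (rule mem)+
  also have "lp_norm p (\<lambda>w. mean i x w - trunc i ?b w)
      \<le> lp_norm p (\<lambda>w. mean i x w - mean i y w) + lp_norm p (\<lambda>w. mean i y w - trunc i ?b w)"
    by (rule lp_norm_triangle[OF p1]) (rule mem)+
  finally have "lp_norm p (\<lambda>w. trunc i ?a w - trunc i ?b w)
      \<le> lp_norm p (\<lambda>w. mean i x w - mean i y w) + 8 * real k"
    using mean_close[OF assms, of x] mean_close[OF assms, of y]
    by (simp add: lp_norm_diff_commute[of p "trunc i ?a"])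
  moreover have "lp_norm p (\<lambda>w. mean i x w - mean i y w) \<le> lp_norm p (\<lambda>l. pmap x l - pmap y l)"
    using lp_slice_le[OF p0 lp_diff(1)[OF p1 pmap_mem[of x] pmap_mem[of y]], of i] assms(1)
    by (simp add: pmap_def)
  ultimately show ?thesis using trunc_diff(2)[OF assms(1) ab] by linarith
qed

end

end

section \<open>The lower bound\<close>

context spqr
begin

definition w_all :: "'v \<Rightarrow> ('i \<times> nat) + ('i \<times> 'v) \<Rightarrow> nat" where
  "w_all x = case_sum (w_long x) (w_short x)"

definition height :: "('i \<times> nat) + ('i \<times> 'v) \<Rightarrow> nat" where
  "height = case_sum snd (nrm \<circ> snd)"

lemma tent_all_eq: "tent p f height w_all x = case_sum (tent p f snd w_long x) (tent p f (nrm \<circ> snd) w_short x)"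
  by (auto simp: tent_def w_all_def height_def split: sum.split)

lemma tent_all:
  assumes "p > 1" "concave_nat f" "\<And>n. 0 \<le> f n" "summable (\<lambda>n. zeta p f n powr p)"
  shows "lp_mem p (tent p f height w_all x)"
    and "\<exists>C\<ge>0. \<forall>x y. E x y \<longrightarrow> lp_norm p (\<lambda>l. tent p f height w_all x l - tent p f height w_all y l) \<le> C"
proof -
  have p: "0 < p" "1 \<le> p" using assms by auto
  show "lp_mem p (tent p f height w_all x)"
    unfolding tent_all_eq by (rule lp_case_sum(1)[OF p(1) tent_long(1)[OF assms] tent_short(1)[OF assms]])
  obtain C1 where C1: "C1 \<ge> 0"
    "\<And>x y. E x y \<Longrightarrow> lp_norm p (\<lambda>l. tent p f snd w_long x l - tent p f snd w_long y l) \<le> C1"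
    using tent_long(2)[OF assms] by blast
  obtain C2 where C2: "C2 \<ge> 0" "\<And>x y. E x y \<Longrightarrow>
      lp_norm p (\<lambda>l. tent p f (nrm \<circ> snd) w_short x l - tent p f (nrm \<circ> snd) w_short y l) \<le> C2"
    using tent_short(2)[OF assms] by blast
  show "\<exists>C\<ge>0. \<forall>x y. E x y \<longrightarrow> lp_norm p (\<lambda>l. tent p f height w_all x l - tent p f height w_all y l) \<le> C"
  proof (intro exI[of _ "C1 + C2"] conjI allI impI)
    fix x y assume "E x y"
    then show "lp_norm p (\<lambda>l. tent p f height w_all x l - tent p f height w_all y l) \<le> C1 + C2"
      unfolding tent_all_eq case_sum_diff
      using lp_case_sum_le[OF p(2) lp_diff(1)[OF p(2) tent_long(1)[OF assms] tent_long(1)[OF assms]]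
          lp_diff(1)[OF p(2) tent_short(1)[OF assms] tent_short(1)[OF assms]], of x y x y] C1(2)[of x y] C2(2)[of x y]
      by linarith
  qed (use C1 C2 in auto)
qed

text \<open>A piece through the point of height \<open>h0\<close> either continues well above it,
  giving a long label, or is entered just above it, giving a short label. If the short label is
  damped by a nearby \<open>bad\<close> vertex, the long piece responsible for that provides a long
  label instead.\<close>

lemma label_near_height:
  assumes h0: "h0 + 5 * k \<le> nrm x" "6 * k + 6 \<le> h0"
  obtains l where "h0 \<le> height l" "height l \<le> h0 + 4 * k" "nrm x - height l \<le> 2 * w_all x l"
proof -
  define z where "z = geo x ! (nrm x - h0)"
  have z: "nrm z = h0" "z \<in> set (geo x)"
    using geodesic_nth[OF geo, of "nrm x - h0" x] geodesic_nth_in_set[OF geo, of "nrm x - h0" x] h0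
    by (auto simp: z_def)
  obtain i where i: "i \<in> I" "z \<in> A i" using cover by blast
  have m: "meets (geo x) (A i)" using z i by (auto simp: meets_def)
  define a where "a = dom_plus (geo x) (A i)"
  note f = dom_facts[OF geo m] and bh = base_height[OF i(1) geo m]
  have zh: "nrm (dom_minus (geo x) (A i)) \<le> h0" "h0 \<le> nrm a"
    using f(6)[OF z(2) i(2)] z(1) by (auto simp: a_def)
  have long: "w_long x (j, h) = nrm x - h"
    if j: "j \<in> I" "meets (geo x) (A j)" and h: "nrm (base j) + 2 * k \<le> h" "h \<le> nrm (gate j (geo x))" for j h
  proof -
    have x: "x \<in> above j h" using h by (simp add: above_def)
    moreover from this have "setdist E x (above j h) = 0" using setdist_le[OF x, of x] by simp
    moreover have "A j \<noteq> {}" using j by (auto simp: meets_def)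
    ultimately show ?thesis using j h unfolding w_long_def by auto
  qed
  show ?thesis
  proof (cases "h0 + 3 * k \<le> nrm a")
    case True
    \<comment> \<open>The exit is no higher than \<open>h0\<close>, hence the base no higher than
      \<open>h0 + k\<close>, and \<open>h0 + 3 * k\<close> reaches the threshold
      \<open>nrm (base i) + 2 * k\<close>.\<close>
    have "w_long x (i, h0 + 3 * k) = nrm x - (h0 + 3 * k)"
      by (rule long) (use i m True bh zh in \<open>auto simp: gate_def a_def\<close>)
    then show ?thesis using that[of "Inl (i, h0 + 3 * k)"] by (simp add: height_def w_all_def)
  next
    case False
    have x: "x \<in> enters i a" using m by (simp add: enters_def a_def)
    then have e0: "setdist E x (enters i a) = 0" using setdist_le[OF x, of x] by simp
    define b where "b = setdist E x (bad (nrm a))"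
    have ws: "w_short x (i, a) = (if bad (nrm a) = {} then nrm x - nrm a else min (nrm x - nrm a) (m * b))"
      using i x e0 zh h0 unfolding w_short_def b_def by auto
    show ?thesis
    proof (cases "nrm x - nrm a \<le> 2 * w_short x (i, a)")
      case True
      then show ?thesis using that[of "Inr (i, a)"] zh False by (simp add: height_def w_all_def)
    next
      case bad: False
      then have ne: "bad (nrm a) \<noteq> {}" and mb: "2 * (m * b) < nrm x - nrm a"
        using ws by (auto simp: min_def split: if_splits)
      obtain y where y: "y \<in> bad (nrm a)" "d x y = b" using setdist_attained[OF ne] unfolding b_def by metis
      then obtain g j where g: "geodesic E y e g" "j \<in> I" "meets g (A j)"
        "real (nrm (dom_minus g (A j))) + 2 * K \<le> real (nrm a)"
        "real (nrm a) \<le> real (nrm (dom_plus g (A j))) - 2 * K"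
        unfolding bad_def by blast
      have deep: "nrm (dom_minus g (A j)) + 2 * k \<le> nrm a" "nrm a + 2 * k \<le> nrm (dom_plus g (A j))"
        using g(4,5) k_le_K by linarith+
      have base: "nrm (base j) + k \<le> nrm a" using base_height(2)[OF g(2,1,3)] deep by linarith
      \<comment> \<open>The point \<open>y\<close> is close to \<open>x\<close> relative to
        \<open>nrm x - nrm a\<close>, so the deep piece of \<open>g\<close> is also seen from
        \<open>x\<close>.\<close>
      have "(meets (geo x) (A j) \<and> d (dom_plus (geo x) (A j)) (dom_plus g (A j)) \<le> k) \<or>
          nrm x + nrm a \<le> 2 * nrm (gate j (geo x))"
        by (rule long_transfer[OF g(2) geo g(1) g(3)]) (use base deep mb y(2) in auto)
      then have gt: "nrm a + k \<le> nrm (gate j (geo x))"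
      proof
        assume c: "meets (geo x) (A j) \<and> d (dom_plus (geo x) (A j)) (dom_plus g (A j)) \<le> k"
        then show ?thesis
          using nrm_le[of "dom_plus g (A j)" "dom_plus (geo x) (A j)"] deep(2)
            gdist_commute[of "dom_plus g (A j)" "dom_plus (geo x) (A j)"] by (simp add: gate_def)
      next
        assume "nrm x + nrm a \<le> 2 * nrm (gate j (geo x))"
        then show ?thesis using False h0 by linarith
      qed
      have mx: "meets (geo x) (A j)"
        using gt base k_pos by (rule_tac ccontr) (simp add: gate_def)
      have "w_long x (j, nrm a + k) = nrm x - (nrm a + k)"
        by (rule long) (use g mx base gt in auto)
      then show ?thesis using that[of "Inl (j, nrm a + k)"] zh False by (simp add: height_def w_all_def)
    qed
  qed
qed

text \<open>Coordinates of short type never reach both points; those of long type force distant gates.\<close>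

lemma shared_label:
  assumes l: "0 < w_all x l" "0 < w_all y l" and n: "d x y = n" "8 * (nrm x - height l) \<le> n"
    "nrm y \<le> nrm x" "8 * k \<le> n" "1 \<le> n"
  obtains i where "i \<in> I" "A i \<noteq> {}" "n \<le> 2 * d (gate i (geo x)) (gate i (geo y))"
proof (cases l)
  case (Inl jh)
  obtain j h where jh: "jh = (j, h)" by (cases jh)
  have w: "0 < w_long x (j, h)" "0 < w_long y (j, h)" and h: "height l = h"
    using l Inl jh by (auto simp: w_all_def height_def)
  \<comment> \<open>Each gate is above \<open>h - k\<close>, so both points are within
    \<open>n / 4\<close> of their gates; at least half of \<open>n\<close> is left between the
    gates.\<close>
  have step: "8 * d z (gate j (geo z)) \<le> n + 8 * k" if z: "0 < w_long z (j, h)" "nrm z \<le> nrm x" for z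
  proof -
    note s = w_long_support[OF z(1)]
    have "d z (gate j (geo z)) = nrm z - nrm (gate j (geo z))"
      using geodesic_start_dist(2)[OF geo dom_facts(2)[OF geo s(4)]] s(4) by (simp add: gate_def)
    moreover have "h \<le> nrm (gate j (geo z)) + k" using s(4,5) by (simp add: gate_def)
    ultimately show ?thesis using z(2) n(2) h by linarith
  qed
  have "n \<le> d x (gate j (geo x)) + d (gate j (geo x)) (gate j (geo y)) + d y (gate j (geo y))"
    using gdist_triangle[of x y "gate j (geo x)"] gdist_triangle[of "gate j (geo x)" y "gate j (geo y)"]
      gdist_commute[of y "gate j (geo y)"] n(1) by linarith
  then have "n \<le> 2 * d (gate j (geo x)) (gate j (geo y))"
    using step[OF w(1)] step[OF w(2) n(3)] n(4) by linarith
  moreover have "j \<in> I" "A j \<noteq> {}" using w_long_support(1,4)[OF w(1)] by (auto simp: meets_def)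
  ultimately show ?thesis using that by blast
next
  case (Inr ia)
  obtain i a where ia: "ia = (i, a)" by (cases ia)
  have w: "0 < w_short x (i, a)" "0 < w_short y (i, a)" and h: "height l = nrm a"
    using l Inr ia by (auto simp: w_all_def height_def)
  \<comment> \<open>A short label fixes the vertex \<open>a\<close> itself. Two points within
    \<open>n / 4\<close> of \<open>a\<close> cannot be at distance \<open>n\<close>.\<close>
  have step: "4 * d z a \<le> n" if z: "0 < w_short z (i, a)" "nrm z \<le> nrm x" for z
  proof -
    obtain v where v: "meets (geo v) (A i)" "dom_plus (geo v) (A i) = a" "m * d z v < nrm z - nrm a"
      by (rule w_short_support[OF z(1)]) blast
    have "d v a = nrm v - nrm a" using geodesic_start_dist(2)[OF geo dom_facts(2)[OF geo v(1)]] v(2) by simp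
    moreover have "20 * d z v \<le> m * d z v" by (simp add: m_def)
    ultimately show ?thesis
      using gdist_triangle[of z a v] nrm_le[of v z] gdist_commute[of v z] v(3) z(2) n(2) h by linarith
  qed
  have "n \<le> d x a + d y a" using gdist_triangle[of x y a] gdist_commute[of a y] n(1) by simp
  then have False using step[OF w(1)] step[OF w(2) n(3)] n(5) by linarith
  then show ?thesis ..
qed

text \<open>The factor 64 combines \<open>f n \<le> 32 * f \<tau>\<close>, by concavity, with a
  weight of at least half of \<open>\<tau>\<close>.\<close>

lemma tent_lower_term:
  assumes p: "p > 1" and f: "concave_nat f" "\<And>n. 0 \<le> f n"
    and \<tau>: "nrm x - height l = \<tau>" "1 \<le> \<tau>" "\<tau> \<le> n" "n \<le> 32 * \<tau>" "\<tau> \<le> 2 * w_all x l"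
  shows "f n powr p / (64 powr p * real n) \<le> \<bar>tent p f height w_all x l\<bar> powr p"
proof -
  have n: "0 < n" using \<tau> by linarith
  have "f n / 64 / real n powr (1 / p) \<le> (f \<tau> / 2) / real n powr (1 / p)"
    using concave_nat_le_mult[OF f \<tau>(2), of n 32] \<tau>(4) by (intro divide_right_mono) auto
  also have "\<dots> \<le> (f \<tau> / 2) / real \<tau> powr (1 / p)"
    using \<tau> f(2)[of \<tau>] p by (intro divide_left_mono powr_mono2 mult_pos_pos) auto
  also have "\<dots> = zeta p f \<tau> * (real \<tau> / 2)"
    using \<tau>(2) by (simp add: zeta_def powr_add)
  also have "\<dots> \<le> zeta p f \<tau> * real (w_all x l)"
    using \<tau>(5) by (intro mult_left_mono zeta_nonneg[OF p f]) linarith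
  also have "\<dots> = \<bar>tent p f height w_all x l\<bar>"
    using zeta_nonneg[OF p f] \<tau>(1) by (simp add: tent_def)
  finally have "(f n / 64 / real n powr (1 / p)) powr p \<le> \<bar>tent p f height w_all x l\<bar> powr p"
    using p f(2)[of n] by (intro powr_mono2) auto
  moreover have "(f n / 64 / real n powr (1 / p)) powr p = f n powr p / (64 powr p * real n)"
    using p f(2)[of n] n by (simp add: powr_divide powr_mult powr_powr)
  ultimately show ?thesis by simp
qed

text \<open>Disjoint height windows supply a number of distinct labels proportional to
  \<open>n\<close>. By \<open>shared_label\<close> and \<open>far\<close> all of them vanish at
  \<open>y\<close>, so the full values at \<open>x\<close> enter the norm.\<close>

lemma tent_lower:
  assumes p: "p > 1" and f: "concave_nat f" "\<And>n. 0 \<le> f n" and sm: "summable (\<lambda>n. zeta p f n powr p)"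
    and n: "d x y = n" "1000 * (k + 1) \<le> n" and xy: "nrm y \<le> nrm x"
    and far: "\<And>i. i \<in> I \<Longrightarrow> A i \<noteq> {} \<Longrightarrow> 2 * d (gate i (geo x)) (gate i (geo y)) < n"
  shows "f n \<le> 64 * (32 * (4 * real k + 1)) powr (1 / p)
    * lp_norm p (\<lambda>l. tent p f height w_all x l - tent p f height w_all y l)"
proof -
  have p0: "0 < p" "1 \<le> p" using p by auto
  \<comment> \<open>\<open>W\<close> is the number of heights in one window of
    \<open>label_near_height\<close>. The \<open>S\<close> windows start at \<open>H\<close> and
    rise by at most \<open>n div 16\<close>, so all labels stay between about \<open>n / 16\<close>
    and \<open>n / 8\<close> below \<open>x\<close>.\<close>
  define W where "W = 4 * k + 1"
  define S where "S = (n div 16) div W"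
  define H where "H = nrm x - n div 8"
  \<comment> \<open>Since \<open>y\<close> is no farther from \<open>e\<close> than
    \<open>x\<close>, the geodesic from \<open>x\<close> is long enough to contain all
    windows.\<close>
  have nx: "n \<le> 2 * nrm x" using gdist_triangle[of x y e] n(1) xy by (simp add: nrm_def gdist_commute)
  have SW: "S * W \<le> n div 16" by (simp add: S_def)
  have nS: "n \<le> 32 * W * S"
  proof -
    have "n div 16 < (S + 1) * W"
      using dividend_less_times_div[of W "n div 16"] by (simp add: S_def W_def algebra_simps)
    moreover have "64 * W \<le> n" using n(2) by (simp add: W_def)
    moreover have "n < 16 * (n div 16) + 16" by linarith
    ultimately show ?thesis by (simp add: algebra_simps)
  qed
  have ex: "\<exists>l. H + s * W \<le> height l \<and> height l < H + Suc s * W \<and> nrm x - height l \<le> 2 * w_all x l"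
    if s: "s < S" for s
  proof -
    have sW: "s * W + W \<le> n div 16"
      using SW mult_le_mono1[of "Suc s" S W] s by simp
    have c: "H + s * W + 5 * k \<le> nrm x"
      using sW n nx by (simp add: H_def W_def)
    have c2: "6 * k + 6 \<le> H + s * W" using n nx by (simp add: H_def)
    obtain l where "H + s * W \<le> height l" "height l \<le> H + s * W + 4 * k" "nrm x - height l \<le> 2 * w_all x l"
      by (rule label_near_height[OF c c2])
    then show ?thesis by (intro exI[of _ l]) (auto simp: W_def)
  qed
  then obtain L where L: "\<And>s. s < S \<Longrightarrow> H + s * W \<le> height (L s)" "\<And>s. s < S \<Longrightarrow> height (L s) < H + Suc s * W"
    "\<And>s. s < S \<Longrightarrow> nrm x - height (L s) \<le> 2 * w_all x (L s)" by metis
  have inj: "inj_on L {..<S}"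
  proof (rule linorder_inj_onI)
    fix s t assume st: "s < t" "s \<in> {..<S}" "t \<in> {..<S}"
    then have "Suc s * W \<le> t * W" by (intro mult_le_mono1) simp
    then have "height (L s) < height (L t)" using L(2)[of s] L(1)[of t] st by simp
    then show "L s \<noteq> L t" by auto
  qed auto
  have \<tau>: "8 * (nrm x - height (L s)) \<le> n" "n \<le> 32 * (nrm x - height (L s))" if s: "s < S" for s
  proof -
    have "Suc s * W \<le> S * W" using s by (intro mult_le_mono1) simp
    then have "Suc s * W \<le> n div 16" using SW by linarith
    then have "height (L s) < H + n div 16" using L(2)[OF s] by linarith
    moreover have "H \<le> height (L s)" using L(1)[OF s] by (meson add_leD1)
    moreover have "H + n div 8 = nrm x" using nx by (simp add: H_def)
    ultimately show "8 * (nrm x - height (L s)) \<le> n" "n \<le> 32 * (nrm x - height (L s))"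
      using n(2) by linarith+
  qed
  have y0: "w_all y (L s) = 0" if s: "s < S" for s
  proof (rule ccontr)
    assume "w_all y (L s) \<noteq> 0"
    moreover have "0 < w_all x (L s)"
      using L(3)[OF s] \<tau>(2)[OF s] n(2) by (cases "w_all x (L s)") auto
    ultimately obtain i where "i \<in> I" "A i \<noteq> {}" "n \<le> 2 * d (gate i (geo x)) (gate i (geo y))"
      using shared_label[of x "L s" y n] n \<tau>(1)[OF s] xy by auto
    then show False using far[of i] by linarith
  qed
  let ?D = "lp_norm p (\<lambda>l. tent p f height w_all x l - tent p f height w_all y l)"
  have memD: "lp_mem p (\<lambda>l. tent p f height w_all x l - tent p f height w_all y l)"
    by (intro lp_diff(1) tent_all(1)) (use p p0 f sm in auto)
  have "real S * (f n powr p / (64 powr p * real n)) = (\<Sum>s<S. f n powr p / (64 powr p * real n))" by simp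
  also have "\<dots> \<le> (\<Sum>s<S. \<bar>tent p f height w_all x (L s)\<bar> powr p)"
  proof (rule sum_mono)
    fix s assume s: "s \<in> {..<S}"
    then have "1 \<le> nrm x - height (L s)" using \<tau>(2)[of s] n(2) by simp
    then show "f n powr p / (64 powr p * real n) \<le> \<bar>tent p f height w_all x (L s)\<bar> powr p"
      using s by (intro tent_lower_term[OF p f refl]) (use \<tau>[of s] L(3)[of s] in auto)
  qed
  also have "\<dots> = (\<Sum>s<S. \<bar>tent p f height w_all x (L s) - tent p f height w_all y (L s)\<bar> powr p)"
    by (intro sum.cong) (auto simp: tent_def y0)
  also have "\<dots> = (\<Sum>l\<in>L ` {..<S}. \<bar>tent p f height w_all x l - tent p f height w_all y l\<bar> powr p)"
    by (simp add: sum.reindex[OF inj])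
  also have "\<dots> \<le> ?D powr p" by (rule sum_le_lp_norm_powr[OF p0(1) memD]) simp
  finally have 1: "real S * (f n powr p / (64 powr p * real n)) \<le> ?D powr p" .
  let ?c = "32 * (4 * real k + 1)"
  have n0: "0 < real n" using n(2) by simp
  have "real n \<le> ?c * real S"
  proof -
    have "real n \<le> real (32 * W * S)" using nS by (rule of_nat_mono)
    then show ?thesis by (simp add: W_def algebra_simps)
  qed
  then have "f n powr p / 64 powr p * real n \<le> f n powr p / 64 powr p * (?c * real S)"
    by (intro mult_left_mono) auto
  then have "f n powr p / 64 powr p \<le> ?c * (real S * (f n powr p / (64 powr p * real n)))"
    using n0 by (simp add: field_simps)
  also have "\<dots> \<le> ?c * ?D powr p" using 1 by (intro mult_left_mono) auto
  finally have "(f n / 64) powr p \<le> (?c powr (1 / p) * ?D) powr p"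
    using p f(2)[of n] by (simp add: powr_divide powr_mult powr_powr)
  then have "f n / 64 \<le> ?c powr (1 / p) * ?D"
    by (rule powr_le_imp_le) (use p0 in auto)
  then show ?thesis by simp
qed

section \<open>Combining the averages and the tents\<close>

lemma countable_vertices: "countable (UNIV :: 'v set)"
proof -
  have "(UNIV :: 'v set) = (\<Union>n. {y. d e y \<le> n})" by auto
  moreover have "countable (\<Union>n. {y. d e y \<le> n})"
    by (rule countable_UN) (simp_all add: countable_finite finite_ball)
  ultimately show ?thesis by (rule ssubst)
qed

lemma embedding_exists:
  fixes \<psi> :: "'i \<Rightarrow> 'v \<Rightarrow> 'w \<Rightarrow> real"
  assumes p: "p > 1"
    and \<psi>_mem: "\<And>i a. i \<in> I \<Longrightarrow> a \<in> A i \<Longrightarrow> lp_mem p (\<psi> i a)"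
    and \<psi>_lip: "\<And>i a b. i \<in> I \<Longrightarrow> a \<in> A i \<Longrightarrow> b \<in> A i \<Longrightarrow>
      lp_norm p (\<lambda>w. \<psi> i a w - \<psi> i b w) \<le> real (d a b)"
    and \<psi>_lower: "\<And>i a b. i \<in> I \<Longrightarrow> a \<in> A i \<Longrightarrow> b \<in> A i \<Longrightarrow>
      \<rho> (real (d a b)) \<le> lp_norm p (\<lambda>w. \<psi> i a w - \<psi> i b w)"
    and \<rho>: "\<forall>t\<ge>0. 0 \<le> \<rho> t" "concave_real \<rho>"
    and f: "concave_nat f" "\<And>n. 0 \<le> f n" and sm: "summable (\<lambda>n. zeta p f n powr p)"
  shows "\<exists>\<phi> :: 'v \<Rightarrow> nat \<Rightarrow> real. (\<forall>x. lp_mem p (\<phi> x)) \<and>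
           (\<exists>C>0. \<forall>x y.
              min (\<rho> (real (d x y))) (f (d x y)) \<le> C * lp_norm p (\<lambda>n. \<phi> x n - \<phi> y n) + C \<and>
              lp_norm p (\<lambda>n. \<phi> x n - \<phi> y n) \<le> C * real (d x y) + C)"
proof -
  have p0: "0 < p" "1 \<le> p" using p by auto
  let ?P = "pmap \<psi>" and ?T = "tent p f height w_all"
  define \<Phi> where "\<Phi> x = case_sum (?P x) (?T x)" for x
  have P: "lp_mem p (?P x)" for x by (rule pmap_mem[where \<psi> = \<psi>, OF p \<psi>_mem \<psi>_lip])
  note T = tent_all(1)[OF p f sm]
  have dP: "lp_mem p (\<lambda>l. ?P x l - ?P y l)" and dT: "lp_mem p (\<lambda>l. ?T x l - ?T y l)" for x y
    by (rule lp_diff(1)[OF p0(2) P P]) (rule lp_diff(1)[OF p0(2) T T])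
  have \<Phi>: "lp_mem p (\<Phi> x)" for x
    unfolding \<Phi>_def by (rule lp_case_sum(1)[OF p0(1) P T])
  have diff: "(\<lambda>l. \<Phi> x l - \<Phi> y l) = case_sum (\<lambda>l. ?P x l - ?P y l) (\<lambda>l. ?T x l - ?T y l)" for x y
    unfolding \<Phi>_def by (rule case_sum_diff)
  obtain C1 where C1: "C1 \<ge> 0" "\<And>x y. E x y \<Longrightarrow> lp_norm p (\<lambda>l. ?P x l - ?P y l) \<le> C1"
    using pmap_lip[where \<psi> = \<psi>, OF p \<psi>_mem \<psi>_lip] by blast
  obtain C2 where C2: "C2 \<ge> 0" "\<And>x y. E x y \<Longrightarrow> lp_norm p (\<lambda>l. ?T x l - ?T y l) \<le> C2"
    using tent_all(2)[OF p f sm] by blast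
  have lip: "lp_norm p (\<lambda>l. \<Phi> x l - \<Phi> y l) \<le> (C1 + C2) * real (d x y)" for x y
  proof (rule lipschitz_from_edges[OF p0(2) \<Phi>])
    fix x y assume "E x y"
    then show "lp_norm p (\<lambda>l. \<Phi> x l - \<Phi> y l) \<le> C1 + C2"
      unfolding diff using lp_case_sum_le[OF p0(2) dP dT, of x y x y] C1(2)[of x y] C2(2)[of x y] by linarith
  qed
  define c where "c = 64 * (32 * (4 * real k + 1)) powr (1 / p)"
  define B where "B = 24 * real k + f (1000 * (k + 1)) + 1"
  have c0: "0 \<le> c" and B0: "0 < B" using f(2)[of "1000 * (k + 1)"] by (auto simp: c_def B_def)
  have lower: "min (\<rho> (real (d x y))) (f (d x y)) \<le> (2 + c) * lp_norm p (\<lambda>l. \<Phi> x l - \<Phi> y l) + B"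
    if xy: "nrm y \<le> nrm x" for x y
  proof -
    let ?n = "d x y" and ?D = "lp_norm p (\<lambda>l. \<Phi> x l - \<Phi> y l)"
    have D: "0 \<le> ?D" "lp_norm p (\<lambda>l. ?P x l - ?P y l) \<le> ?D" "lp_norm p (\<lambda>l. ?T x l - ?T y l) \<le> ?D"
      unfolding diff by (auto intro: lp_case_sum[OF p0(1) dP dT])
    have cD: "0 \<le> c * ?D" "0 \<le> 2 * ?D" using c0 D(1) by auto
    \<comment> \<open>Small distances are absorbed by \<open>B\<close>. Otherwise either some piece
      has distant gates, and the averages give the bound, or no piece has, and the tents do.\<close>
    consider "?n < 1000 * (k + 1)"
      | i where "1000 * (k + 1) \<le> ?n" "i \<in> I" "A i \<noteq> {}" "?n \<le> 2 * d (gate i (geo x)) (gate i (geo y))"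
      | "1000 * (k + 1) \<le> ?n" "\<And>i. i \<in> I \<Longrightarrow> A i \<noteq> {} \<Longrightarrow> 2 * d (gate i (geo x)) (gate i (geo y)) < ?n"
      by (metis not_le)
    then show ?thesis
    proof cases
      case 1
      then have "f ?n \<le> f (1000 * (k + 1))" using f(1) by (simp add: concave_nat_def mono_def)
      then show ?thesis using cD unfolding B_def distrib_right by linarith
    next
      case (2 i)
      let ?a = "gate i (geo x)" and ?b = "gate i (geo y)"
      have ab: "?a \<in> A i" "?b \<in> A i" using gate_in[OF 2(3) geo] by auto
      have mono: "\<And>s t. 0 \<le> s \<Longrightarrow> s \<le> t \<Longrightarrow> \<rho> s \<le> \<rho> t" using \<rho>(2) by (simp add: concave_real_def)
      have "\<rho> (real ?n) \<le> \<rho> (2 * real (d ?a ?b))" using 2(4) by (intro mono) linarith+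
      also have "\<dots> \<le> 2 * \<rho> (real (d ?a ?b))" by (rule concave_real_double[OF \<rho>(2,1)]) simp
      also have "\<rho> (real (d ?a ?b)) \<le> lp_norm p (\<lambda>w. \<psi> i ?a w - \<psi> i ?b w)"
        by (rule \<psi>_lower[OF 2(2) ab])
      also have "\<dots> \<le> lp_norm p (\<lambda>l. ?P x l - ?P y l) + 12 * real k"
        by (rule pmap_lower[where \<psi> = \<psi>]) (use p \<psi>_mem \<psi>_lip 2 in auto)
      finally have "\<rho> (real ?n) \<le> 2 * (lp_norm p (\<lambda>l. ?P x l - ?P y l) + 12 * real k)" by simp
      also have "\<dots> \<le> 2 * (?D + 12 * real k)" using D(2) by simp
      also have "\<dots> = 2 * ?D + 24 * real k" by (simp add: distrib_left)
      also have "\<dots> \<le> (2 * ?D + c * ?D) + B"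
        using cD f(2)[of "1000 * (k + 1)"] unfolding B_def by (intro add_mono) auto
      also have "\<dots> = (2 + c) * ?D + B" by (simp add: distrib_right)
      finally show ?thesis by (rule min.coboundedI1)
    next
      case 3
      have "f ?n \<le> c * lp_norm p (\<lambda>l. ?T x l - ?T y l)"
        unfolding c_def by (rule tent_lower[OF p f sm refl 3(1) xy 3(2)])
      also have "\<dots> \<le> c * ?D" using D(3) c0 by (rule mult_left_mono)
      finally show ?thesis using cD B0 unfolding distrib_right by linarith
    qed
  qed
  \<comment> \<open>The estimate follows the geodesic of the point farther from \<open>e\<close>;
    exchanging the points covers the other order.\<close>
  have lower': "min (\<rho> (real (d x y))) (f (d x y)) \<le> (2 + c) * lp_norm p (\<lambda>l. \<Phi> x l - \<Phi> y l) + B" for x y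
  proof (cases "nrm y \<le> nrm x")
    case False
    then show ?thesis using lower[of x y] by (simp add: gdist_commute[of y x] lp_norm_diff_commute[of p "\<Phi> y"])
  qed (rule lower)
  \<comment> \<open>Each vertex has countably many nonzero coordinates and there are countably many
    vertices, so the labels can be numbered.\<close>
  have cnt: "countable (\<Union>x. {l. \<Phi> x l \<noteq> 0})"
    by (intro countable_UN countable_vertices lp_support_countable[OF p0(1) \<Phi>])
  obtain \<phi> :: "'v \<Rightarrow> nat \<Rightarrow> real" where \<phi>: "\<And>x. lp_mem p (\<phi> x) \<longleftrightarrow> lp_mem p (\<Phi> x)"
    "\<And>x y. lp_norm p (\<lambda>n. \<phi> x n - \<phi> y n) = lp_norm p (\<lambda>l. \<Phi> x l - \<Phi> y l)"
    using lp_countable_to_nat[OF cnt _ p0(1), of \<Phi>] by auto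
  define C where "C = (2 + c) + B + (C1 + C2)"
  have C: "0 < C" "2 + c \<le> C" "B \<le> C" "C1 + C2 \<le> C" using c0 B0 C1 C2 by (auto simp: C_def)
  show ?thesis
  proof (intro exI[of _ \<phi>] exI[of _ C] conjI allI)
    show "lp_mem p (\<phi> x)" for x using \<phi> \<Phi> by simp
    show "0 < C" by (rule C)
    fix x y
    let ?D = "lp_norm p (\<lambda>l. \<Phi> x l - \<Phi> y l)"
    show "min (\<rho> (real (d x y))) (f (d x y)) \<le> C * lp_norm p (\<lambda>n. \<phi> x n - \<phi> y n) + C"
      using lower'[of x y] mult_right_mono[OF C(2), of ?D] C(3) unfolding \<phi>(2) by simp
    show "lp_norm p (\<lambda>n. \<phi> x n - \<phi> y n) \<le> C * real (d x y) + C"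
      using lip[of x y] mult_right_mono[OF C(4), of "real (d x y)"] C(1) unfolding \<phi>(2) by simp
  qed
qed

end

lemma SPQR_rel_hyp_imp_spqr:
  assumes "SPQR_rel_hyp E A I e"
  obtains K k where "spqr E A I e K k"
proof -
  from assms obtain K where sg: "simplicial_graph E" and cg: "connected_graph E" and bd: "bounded_degree E"
    and I: "(\<Union>i\<in>I. A i) = UNIV" and K: "K > 0"
    and C1: "\<forall>i\<in>I. \<forall>x1 x2 g1 g2. geodesic E x1 e g1 \<longrightarrow> geodesic E x2 e g2 \<longrightarrow>
          meets g1 (A i) \<longrightarrow> meets g2 (A i) \<longrightarrow>
          real (gdist E (dom_minus g1 (A i)) (dom_minus g2 (A i))) \<le> K"
    and C2: "\<forall>i\<in>I. \<forall>x y gx gy.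
          real (gdist E x y) \<le> max (real (setdist E x (A i)) / 4) 1 \<longrightarrow>
          geodesic E x e gx \<longrightarrow> geodesic E y e gy \<longrightarrow>
          (meets gx (A i) \<longrightarrow> meets gy (A i) \<longrightarrow>
             real (gdist E (dom_plus gx (A i)) (dom_plus gy (A i))) \<le> K) \<and>
          (meets gx (A i) \<longrightarrow> \<not> meets gy (A i) \<longrightarrow> real (ilen E gx (A i)) \<le> K)"
    and C3: "\<forall>x. finite {i\<in>I. x \<in> A i} \<and> 1 \<le> card {i\<in>I. x \<in> A i} \<and> real (card {i\<in>I. x \<in> A i}) \<le> K"
    and C4: "\<forall>x. \<forall>t::nat. finite {i\<in>Ix E e A I K x. setdist E x (A i) = t} \<and>
           real (card {i\<in>Ix E e A I K x. setdist E x (A i) = t}) \<le> K"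
    unfolding SPQR_rel_hyp_def by (elim conjE exE) (rule that)
  define k where "k = nat \<lfloor>K\<rfloor>"
  have le: "n \<le> k" if "real n \<le> K" for n using that unfolding k_def by (rule le_nat_floor)
  have near: "real (gdist E x y) \<le> max (real (setdist E x (A i)) / 4) 1"
    if "4 * gdist E x y \<le> setdist E x (A i) \<or> gdist E x y \<le> 1" for x y i
    using that by linarith
  have "spqr E A I e K k"
  proof
    show "E x y \<Longrightarrow> E y x" for x y using sg by (simp add: simplicial_graph_def)
    show "real k \<le> K" "K < real k + 1" using K by (auto simp: k_def)
    \<comment> \<open>By (C3) the number of pieces through a vertex is at least 1 and at most
      \<open>K\<close>.\<close>
    show "1 \<le> k" using C3 le by (meson le_trans)
    show "gdist E (dom_minus g1 (A i)) (dom_minus g2 (A i)) \<le> k"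
      if "i \<in> I" "geodesic E x1 e g1" "geodesic E x2 e g2" "meets g1 (A i)" "meets g2 (A i)" for i x1 x2 g1 g2
      using C1[rule_format, OF that] by (rule le)
    show "gdist E (dom_plus gx (A i)) (dom_plus gy (A i)) \<le> k"
      if i: "i \<in> I" and xy: "4 * gdist E x y \<le> setdist E x (A i) \<or> gdist E x y \<le> 1"
        and g: "geodesic E x e gx" "geodesic E y e gy" "meets gx (A i)" "meets gy (A i)" for i x y gx gy
      using C2[rule_format, OF i near[OF xy] g(1,2)] g(3,4) le by blast
    show "ilen E gx (A i) \<le> k"
      if i: "i \<in> I" and xy: "4 * gdist E x y \<le> setdist E x (A i) \<or> gdist E x y \<le> 1"
        and g: "geodesic E x e gx" "geodesic E y e gy" "meets gx (A i)" "\<not> meets gy (A i)" for i x y gx gy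
      using C2[rule_format, OF i near[OF xy] g(1,2)] g(3,4) le by blast
    show "card {i \<in> I. x \<in> A i} \<le> k" "finite {i \<in> I. x \<in> A i}" for x using C3 le by blast+
    show "finite {i \<in> Ix E e A I K x. setdist E x (A i) = t}"
      "card {i \<in> Ix E e A I K x. setdist E x (A i) = t} \<le> k" for x t using C4 le by blast+
  qed (fact cg bd I)+
  then show ?thesis by (rule that)
qed

theorem theorem5p4:
  fixes E :: "'v \<Rightarrow> 'v \<Rightarrow> bool" and A :: "'i \<Rightarrow> 'v set" and I :: "'i set" and e :: 'v
    and p :: real and \<psi> :: "'i \<Rightarrow> 'v \<Rightarrow> 'w \<Rightarrow> real" and \<rho>' :: "real \<Rightarrow> real"
    and f :: "nat \<Rightarrow> real"
  assumes p: "p > 1"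
    and hyp: "SPQR_rel_hyp E A I e"
    and psi_lp: "\<forall>i\<in>I. \<forall>x\<in>A i. lp_mem p (\<psi> i x)"
    and rho'_nonneg: "\<forall>t\<ge>0. \<rho>' t \<ge> 0"
    and rho'_conc: "concave_real \<rho>'"
    and psi_bounds: "\<forall>i\<in>I. \<forall>x\<in>A i. \<forall>y\<in>A i.
        \<rho>' (real (gdist E x y)) \<le> lp_norm p (\<lambda>w. \<psi> i x w - \<psi> i y w) \<and>
        lp_norm p (\<lambda>w. \<psi> i x w - \<psi> i y w) \<le> real (gdist E x y)"
    and f_nonneg: "\<forall>n. f n \<ge> 0"
    and f_C: "prop_Cpc p f"
  shows "\<exists>\<phi> :: 'v \<Rightarrow> nat \<Rightarrow> real. (\<forall>x. lp_mem p (\<phi> x)) \<and>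
           (\<exists>C>0. \<forall>x y.
              min (\<rho>' (real (gdist E x y))) (f (gdist E x y))
                \<le> C * lp_norm p (\<lambda>n. \<phi> x n - \<phi> y n) + C \<and>
              lp_norm p (\<lambda>n. \<phi> x n - \<phi> y n) \<le> C * real (gdist E x y) + C)"
proof -
  obtain K k where "spqr E A I e K k" using SPQR_rel_hyp_imp_spqr[OF hyp] .
  then interpret spqr E A I e K k .
  have f: "concave_nat f" "\<And>n. 0 \<le> f n" using f_C f_nonneg by (auto simp: prop_Cpc_def)
  have sm: "summable (\<lambda>n. zeta p f n powr p)"
    using f_C by (intro zeta_summable[OF p f]) (simp add: prop_Cpc_def)
  show ?thesis
    by (rule embedding_exists[OF p _ _ _ rho'_nonneg rho'_conc f sm]) (use psi_lp psi_bounds in auto)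
qed

end
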